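(* There exists a constant $c>0$ such that for all sufficiently large $n$, every coloring of the edges of the transitive tournament on $n$ vertices with three colors contains a directed path with at least $c\sqrt{n}\cdot e^{\log^* n}$ vertices which avoids at least one of the three colors (i.e., at least one color does not appear on any edge of the path).
   Context: The transitive tournament on $n$ vertices has vertex set $\{1,\ldots,n\}$, and for each pair $i<j$ the edge between them is oriented from $i$ to $j$. A directed path is a sequence of vertices $v_1<v_2<\cdots<v_m$ using the edges $\overrightarrow{v_sv_{s+1}}$; its length is measured by its number of vertices $m$. Here $\log^*$ denotes the iterated logarithm, the inverse of the tower function $T$ defined by $T(0)=1$ and $T(m)=2^{T(m-1)}$. *)

theory Defs
  imports Complex_Main
begin

definition tournament_edges :: "nat \<Rightarrow> (nat \<times> nat) set" where
  "tournament_edges n = {(i, j). 1 \<le> i \<and> i < j \<and> j \<le> n}"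

text \<open>A directed path is given by the list of its vertices; its length is the number of
  vertices, so it is the list length.\<close>

definition directed_path :: "nat \<Rightarrow> nat list \<Rightarrow> bool" where
  "directed_path n p \<longleftrightarrow> p \<noteq> [] \<and> set p \<subseteq> {1..n} \<and> sorted_wrt (<) p"

definition path_edges :: "nat list \<Rightarrow> (nat \<times> nat) set" where
  "path_edges p = set (zip p (tl p))"

fun tower :: "nat \<Rightarrow> nat" where
  "tower 0 = 1"
| "tower (Suc m) = 2 ^ tower m"

text \<open>For \<open>n \<ge> 1\<close> this is the number of times the binary logarithm has to be applied to \<open>n\<close>
  until the result is at most 1. Rounding down instead would change the value by at most 1.\<close>

definition log_star :: "nat \<Rightarrow> nat" where
  "log_star n = (LEAST m. n \<le> tower m)"

lemma path_edges_subset: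
  assumes "directed_path n p"
  shows "path_edges p \<subseteq> tournament_edges n"
proof
  fix e assume "e \<in> path_edges p"
  then obtain s where s: "s < length p" "s < length (tl p)" "e = (p ! s, tl p ! s)"
    by (auto simp: path_edges_def in_set_zip prod_eq_iff)
  then have "Suc s < length p" "e = (p ! s, p ! Suc s)"
    by (auto simp: nth_tl)
  moreover from this have "p ! s \<in> set p" "p ! Suc s \<in> set p" by auto
  moreover have "p ! s < p ! Suc s"
    using assms \<open>Suc s < length p\<close>
    by (auto simp: directed_path_def intro: sorted_wrt_nth_less)
  ultimately show "e \<in> tournament_edges n"
    using assms unfolding directed_path_def tournament_edges_def
    by (auto simp: subset_iff)
qed

end

theory Submission
  imports Defs
begin

text \<open>
  Send a vertex \<open>v\<close> to the triple of lengths of the longest paths ending in \<open>v\<close> that avoid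
  colour 1, 2, 3. If \<open>u < v\<close> then two of the three coordinates increase strictly from \<open>u\<close> to \<open>v\<close>,
  so vertices sharing one coordinate form a strict chain in the other two. It suffices to bound the
  size of such a set \<open>S\<close> inside a cube of side \<open>L\<close>: it is less than \<open>L\<^sup>2 / D\<close> as soon as \<open>L\<close> is
  exponential in a fixed power of \<open>D\<close>, which is far better than what the triangle removal lemma gives.

  Regard \<open>z\<close> as a partial function of \<open>(x, y)\<close>. It increases along rows and along columns, while its
  level sets are increasing chains; a smooth function cannot do this. To make this precise for a
  dense \<open>S\<close>, choose by an energy pigeonhole a range of scales on which most rows and columns meet
  almost all windows of the smallest size \<open>w\<close>. At each scale in the range, compare two routes from
  a typical point: along its level set, and along a staircase inside \<open>S\<close> which strictly raises \<open>z\<close>.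
  Both can be made to end in the same window of size \<open>w\<close> in \<open>x\<close> and \<open>y\<close>, so that over this window
  \<open>z\<close> takes two values that differ by about the given scale. This happens for a positive proportion
  of the windows at every scale, so over an average window \<open>z\<close> takes many well separated values.
  But a chain passes through at most \<open>2 L / w\<close> pairs of blocks of size \<open>w\<close>; after discarding the
  sparsely filled ones every occupied cell of size \<open>w\<close> contains a positive multiple of \<open>w\<^sup>2\<close> points,
  and there is no room for so many occupied cells.
\<close>

section \<open>Chains and blocks\<close>

text \<open>The coordinates are functions on an abstract set, so that they can be permuted freely
  and the vertices themselves can serve as points. Applied to \<open>p\<close>, \<open>r\<close> and
  to \<open>r\<close>, \<open>p\<close>, the condition makes \<open>h\<close> injective on fibres of
  \<open>f\<close> as well.\<close>

definition chain_fibres :: "'a set \<Rightarrow> ('a \<Rightarrow> nat) \<Rightarrow> ('a \<Rightarrow> nat) \<Rightarrow> ('a \<Rightarrow> nat) \<Rightarrow> bool" where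
  "chain_fibres S f g h \<longleftrightarrow>
     (\<forall>p\<in>S. \<forall>r\<in>S. f p = f r \<longrightarrow> (g p < g r \<longleftrightarrow> h p < h r) \<and> (g p = g r \<longrightarrow> p = r))"

lemma chain_fibresD:
  assumes "chain_fibres S f g h" "p \<in> S" "r \<in> S" "f p = f r"
  shows "g p < g r \<longleftrightarrow> h p < h r" "g p = g r \<Longrightarrow> p = r" "h p = h r \<Longrightarrow> p = r"
proof -
  have D: "(g a < g b \<longleftrightarrow> h a < h b) \<and> (g a = g b \<longrightarrow> a = b)"
    if "a \<in> S" "b \<in> S" "f a = f b" for a b
    using assms(1) that unfolding chain_fibres_def by blast
  have 1: "g p < g r \<longleftrightarrow> h p < h r" and 2: "g p = g r \<longrightarrow> p = r"
    using D[of p r] assms by blast+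
  have 3: "g r < g p \<longleftrightarrow> h r < h p" using D[of r p] assms by simp
  show "g p < g r \<longleftrightarrow> h p < h r" by (rule 1)
  show "g p = g r \<Longrightarrow> p = r" using 2 by blast
  show "h p = h r \<Longrightarrow> p = r" using 1 2 3 by (metis less_irrefl nat_neq_iff)
qed

lemma div_less_div:
  assumes "u dvd L" "u > 0" "a < (L::nat)"
  shows "a div u < L div u"
  using assms by (metis dvd_div_mult_self less_mult_imp_div_less)

text \<open>Along a monotone staircase of blocks the sum of the two block indices is strictly increasing.\<close>

lemma card_pieces_le:
  assumes ch: "chain_fibres S f g h" and u: "u > 0" "u dvd L"
    and bd: "\<And>p. p \<in> S \<Longrightarrow> f p < L \<and> g p < L \<and> h p < L"
  shows "card ((\<lambda>p. (f p, g p div u, h p div u)) ` S) \<le> 2 * L * (L div u)"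
proof -
  let ?P = "(\<lambda>p. (f p, g p div u, h p div u)) ` S"
  let ?s = "\<lambda>(l::nat, a::nat, b::nat). (l, a + b)"
  have key: "g p div u = g r div u \<and> h p div u = h r div u"
    if p: "p \<in> S" and r: "r \<in> S" and "f p = f r"
      and s: "g p div u + h p div u = g r div u + h r div u" for p r
  proof (cases "g p < g r")
    case True
    then have "h p < h r" using chain_fibresD(1)[OF ch p r \<open>f p = f r\<close>] by simp
    then have "g p div u \<le> g r div u" "h p div u \<le> h r div u"
      using True by (auto intro: div_le_mono)
    with s show ?thesis by linarith
  next
    case False
    then have "\<not> h p < h r" using chain_fibresD(1)[OF ch p r \<open>f p = f r\<close>] by simp
    then have "g r div u \<le> g p div u" "h r div u \<le> h p div u"
      using False by (auto intro: div_le_mono)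
    with s show ?thesis by linarith
  qed
  have inj: "inj_on ?s ?P"
    by (rule inj_onI) (use key in auto)
  have "?s ` ?P \<subseteq> {..<L} \<times> {..<2 * (L div u)}"
    using bd by (auto simp: mult_2 intro!: add_strict_mono div_less_div u)
  then have "card (?s ` ?P) \<le> card ({..<L} \<times> {..<2 * (L div u)})"
    by (intro card_mono) auto
  then show ?thesis using card_image[OF inj] by simp
qed

text \<open>Inside one class of \<open>key\<close>, distinct elements have distinct numbers of
  elements above them, so fewer than \<open>k\<close> above is possible for at most \<open>k\<close>
  elements. Integer ranks allow the order to be reversed by negation.\<close>

lemma card_low_rank_le:
  fixes ord :: "'a \<Rightarrow> int"
  assumes fin: "finite T"
    and inj: "\<And>p r. p \<in> T \<Longrightarrow> r \<in> T \<Longrightarrow> key p = key r \<Longrightarrow> ord p = ord r \<Longrightarrow> p = r"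
  shows "card {p\<in>T. card {r\<in>T. key r = key p \<and> ord p < ord r} < k} \<le> k * card (key ` T)"
proof -
  let ?up = "\<lambda>p. {r\<in>T. key r = key p \<and> ord p < ord r}"
  let ?B = "\<lambda>c. {p\<in>T. key p = c \<and> card (?up p) < k}"
  have one: "card (?B c) \<le> k" for c
  proof -
    have lt: "card (?up r) < card (?up p)"
      if "p \<in> ?B c" "r \<in> ?B c" "ord p < ord r" for p r
    proof (rule psubset_card_mono)
      show "finite (?up p)" using fin by simp
      show "?up r \<subset> ?up p"
      proof
        show "?up r \<subseteq> ?up p" using that by auto
        have "r \<in> ?up p" "r \<notin> ?up r" using that by auto
        then show "?up r \<noteq> ?up p" by blast
      qed
    qed
    have "inj_on (\<lambda>p. card (?up p)) (?B c)"
    proof (rule inj_onI)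
      fix p r assume pr: "p \<in> ?B c" "r \<in> ?B c" "card (?up p) = card (?up r)"
      then have "ord p = ord r" using lt[of p r] lt[of r p] by fastforce
      then show "p = r" using inj pr by auto
    qed
    moreover have "(\<lambda>p. card (?up p)) ` ?B c \<subseteq> {..<k}" by auto
    ultimately show ?thesis
      using card_inj_on_le[of "\<lambda>p. card (?up p)" "?B c" "{..<k}"] by simp
  qed
  have "{p\<in>T. card (?up p) < k} = (\<Union>c\<in>key ` T. ?B c)" by auto
  then have "card {p\<in>T. card (?up p) < k} \<le> (\<Sum>c\<in>key ` T. card (?B c))"
    using card_UN_le[of "key ` T" ?B] fin by simp
  also have "\<dots> \<le> (\<Sum>c\<in>key ` T. k)" by (intro sum_mono one)
  finally show ?thesis by (simp add: mult.commute)
qed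

lemma card_light_le:
  assumes fin: "finite T"
  shows "card {p\<in>T. card {r\<in>T. key r = key p} < k} \<le> k * card (key ` T)"
proof -
  let ?B = "\<lambda>c. {p\<in>T. key p = c \<and> card {r\<in>T. key r = key p} < k}"
  have one: "card (?B c) \<le> k" for c
  proof (cases "?B c = {}")
    case False
    then obtain p where p: "p \<in> ?B c" by auto
    have "card (?B c) \<le> card {r\<in>T. key r = key p}"
      using fin p by (intro card_mono) auto
    moreover from p have "card {r\<in>T. key r = key p} < k" by blast
    ultimately show ?thesis by linarith
  qed (metis card.empty zero_le)
  have "{p\<in>T. card {r\<in>T. key r = key p} < k} = (\<Union>c\<in>key ` T. ?B c)" by auto
  then have "card {p\<in>T. card {r\<in>T. key r = key p} < k} \<le> (\<Sum>c\<in>key ` T. card (?B c))"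
    using card_UN_le[of "key ` T" ?B] fin by simp
  also have "\<dots> \<le> (\<Sum>c\<in>key ` T. k)" by (intro sum_mono one)
  finally show ?thesis by (simp add: mult.commute)
qed

text \<open>The \<open>q\<close> points above \<open>p\<close> have distinct values of
  \<open>g\<close>, so one of them, \<open>a\<close>, has \<open>g a\<close> at least
  \<open>g p + q\<close> and lies beyond \<open>r\<close>. Then \<open>h r\<close> is squeezed
  between \<open>h p\<close> and \<open>h a\<close>, which share a block of size
  \<open>Q\<close>.\<close>

lemma chain_reach_up:
  assumes ch: "chain_fibres S f g h" and pr: "p \<in> S" "r \<in> S" "f r = f p"
    and lt: "g p < g r" "g r < g p + q"
    and many: "q \<le> card {a\<in>S. f a = f p \<and> g a div Q = g p div Q \<and> h a div Q = h p div Q \<and> g p < g a}"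
      (is "q \<le> card ?A")
  shows "h r div Q = h p div Q"
proof -
  have "\<exists>a\<in>?A. g p + q \<le> g a"
  proof (rule ccontr)
    assume "\<not> ?thesis"
    then have sub: "g ` ?A \<subseteq> {g p<..<g p + q}" by auto
    have "inj_on g ?A"
      by (rule inj_onI) (use chain_fibresD(2)[OF ch] in auto)
    then have "card ?A \<le> card {g p<..<g p + q}"
      using sub by (intro card_inj_on_le) auto
    then show False using many lt by simp
  qed
  then obtain a where a: "a \<in> ?A" "g r < g a" using lt by force
  then have "h r < h a" "h p < h r"
    using chain_fibresD(1)[OF ch, of r a] chain_fibresD(1)[OF ch, of p r] pr lt by auto
  then have "h r div Q \<le> h a div Q" "h p div Q \<le> h r div Q"
    by (auto intro: div_le_mono)
  with a show ?thesis by auto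
qed

lemma chain_reach_down:
  assumes ch: "chain_fibres S f g h" and pr: "p \<in> S" "r \<in> S" "f r = f p"
    and lt: "g r < g p" "g p < g r + q"
    and many: "q \<le> card {a\<in>S. f a = f p \<and> g a div Q = g p div Q \<and> h a div Q = h p div Q \<and> g a < g p}"
      (is "q \<le> card ?A")
  shows "h r div Q = h p div Q"
proof -
  have "\<exists>a\<in>?A. g a + q \<le> g p"
  proof (rule ccontr)
    assume "\<not> ?thesis"
    then have sub: "g ` ?A \<subseteq> {g p + 1 - q..<g p}" by (auto simp: not_le)
    have "inj_on g ?A"
      by (rule inj_onI) (use chain_fibresD(2)[OF ch] in auto)
    then have "card ?A \<le> card {g p + 1 - q..<g p}"
      using sub by (intro card_inj_on_le) auto
    then show False using many lt by simp
  qed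
  then obtain a where a: "a \<in> ?A" "g a < g r" using lt by force
  then have "h a < h r" "h r < h p"
    using chain_fibresD(1)[OF ch, of a r] chain_fibresD(1)[OF ch, of r p] pr lt by auto
  then have "h a div Q \<le> h r div Q" "h r div Q \<le> h p div Q"
    by (auto intro: div_le_mono)
  with a show ?thesis by auto
qed

section \<open>Energy and empty windows\<close>

definition window_count :: "'a set \<Rightarrow> ('a \<Rightarrow> nat) \<Rightarrow> ('a \<Rightarrow> nat) \<Rightarrow> nat \<Rightarrow> nat \<Rightarrow> nat \<Rightarrow> nat" where
  "window_count S f g u l i = card {p\<in>S. f p = l \<and> g p div u = i}"

text \<open>Each summand is \<open>u\<close> times the squared density of \<open>S\<close> in a
  window, so this is the mean square density of an energy increment argument, scaled by
  \<open>L^2\<close>.\<close>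

definition energy :: "'a set \<Rightarrow> ('a \<Rightarrow> nat) \<Rightarrow> ('a \<Rightarrow> nat) \<Rightarrow> nat \<Rightarrow> nat \<Rightarrow> real" where
  "energy S f g L u = (\<Sum>l<L. \<Sum>i<L div u. (real (window_count S f g u l i))\<^sup>2 / real u)"

text \<open>Two sets are needed: the block is dense with respect to \<open>S\<close>, whose energy
  is controlled, while the window is missed by a pruned set \<open>T\<close>.\<close>

definition gaps :: "'a set \<Rightarrow> 'a set \<Rightarrow> ('a \<Rightarrow> nat) \<Rightarrow> ('a \<Rightarrow> nat) \<Rightarrow> nat \<Rightarrow> nat \<Rightarrow> nat \<Rightarrow> nat \<Rightarrow> (nat \<times> nat) set"
  where "gaps S T f g L w t K =
    {(l, i). l < L \<and> i < L div w \<and> K \<le> window_count S f g (w * t) l (i div t) \<and>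
             (\<forall>p\<in>T. \<not> (f p = l \<and> g p div w = i))}"

lemma window_count_le:
  assumes "u > 0" and inj: "\<And>p r. p \<in> S \<Longrightarrow> r \<in> S \<Longrightarrow> f p = f r \<Longrightarrow> g p = g r \<Longrightarrow> p = r"
  shows "window_count S f g u l i \<le> u"
proof -
  have "inj_on (\<lambda>p. g p mod u) {p\<in>S. f p = l \<and> g p div u = i}"
    by (rule inj_onI) (metis (mono_tags, lifting) div_mult_mod_eq inj mem_Collect_eq)
  moreover have "(\<lambda>p. g p mod u) ` {p\<in>S. f p = l \<and> g p div u = i} \<subseteq> {..<u}"
    using assms(1) by auto
  ultimately show ?thesis unfolding window_count_def
    using card_inj_on_le[of "\<lambda>p. g p mod u" _ "{..<u}"] by fastforce
qed

lemma energy_nonneg: "0 \<le> energy S f g L u"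
  unfolding energy_def by (intro sum_nonneg) auto

lemma energy_le:
  assumes "u > 0" "u dvd L"
    and inj: "\<And>p r. p \<in> S \<Longrightarrow> r \<in> S \<Longrightarrow> f p = f r \<Longrightarrow> g p = g r \<Longrightarrow> p = r"
  shows "energy S f g L u \<le> (real L)\<^sup>2"
proof -
  have "(real (window_count S f g u l i))\<^sup>2 / real u \<le> real u" for l i
  proof -
    have "(real (window_count S f g u l i))\<^sup>2 \<le> (real u)\<^sup>2"
      using window_count_le[OF assms(1) inj, where S=S] by (intro power_mono) auto
    then show ?thesis using assms(1) by (simp add: divide_le_eq power2_eq_square)
  qed
  then have "energy S f g L u \<le> (\<Sum>l<L. \<Sum>i<L div u. real u)"
    unfolding energy_def by (intro sum_mono)
  also have "\<dots> = (real L)\<^sup>2"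
    using assms by (simp add: power2_eq_square real_of_nat_div)
  finally show ?thesis .
qed

lemma sum_lessThan_mult:
  fixes F :: "nat \<Rightarrow> 'b::comm_monoid_add"
  shows "(\<Sum>i<m * t. F i) = (\<Sum>I<m. \<Sum>i\<in>{I * t..<I * t + t}. F i)"
  by (simp add: sum.nat_group)

lemma window_count_split:
  assumes "finite S" "t > 0"
  shows "window_count S f g (w * t) l I = (\<Sum>i\<in>{I * t..<I * t + t}. window_count S f g w l i)"
proof -
  have eq: "{p\<in>S. f p = l \<and> g p div (w * t) = I} =
    (\<Union>i\<in>{I * t..<I * t + t}. {p\<in>S. f p = l \<and> g p div w = i})"
  proof -
    have "a div t = I \<longleftrightarrow> a \<in> {I * t..<I * t + t}" for a
    proof
      assume I: "a div t = I"
      have "a div t * t \<le> a" "a < t + a div t * t"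
        using dividend_less_div_times[OF assms(2)] by simp_all
      then show "a \<in> {I * t..<I * t + t}" unfolding I by simp
    next
      assume "a \<in> {I * t..<I * t + t}"
      then show "a div t = I" by (intro div_nat_eqI) (simp_all add: mult.commute)
    qed
    then have *: "g p div (w * t) = I \<longleftrightarrow> g p div w \<in> {I * t..<I * t + t}" for p
      by (simp only: div_mult2_eq)
    show ?thesis unfolding * by blast
  qed
  show ?thesis unfolding window_count_def eq
    by (rule card_UN_disjoint) (use assms in auto)
qed

text \<open>Pythagoras: in each block of \<open>t\<close> windows the sum of squares splits into the
  contribution of the block mean and the squared deviations from it.\<close>

lemma energy_diff:
  assumes fin: "finite S" and "w > 0" "t > 0" "w * t dvd L"
  shows "energy S f g L w - energy S f g L (w * t) =
    (\<Sum>l<L. \<Sum>i<L div w.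
      (real (window_count S f g w l i) - real (window_count S f g (w * t) l (i div t)) / t)\<^sup>2 / real w)"
proof -
  define m where "m = L div (w * t)"
  have L: "L = w * t * m" using assms by (simp add: m_def)
  have Lw: "L div w = m * t" using L assms by (simp add: mult.commute mult.left_commute)
  let ?n = "\<lambda>l i. real (window_count S f g w l i)"
  let ?N = "\<lambda>l I. real (window_count S f g (w * t) l I)"
  have block: "(\<Sum>i\<in>{I * t..<I * t + t}. (?n l i)\<^sup>2 / w) - (?N l I)\<^sup>2 / real (w * t) =
    (\<Sum>i\<in>{I * t..<I * t + t}. (?n l i - ?N l (i div t) / t)\<^sup>2 / w)" for l I
  proof -
    let ?R = "{I * t..<I * t + t}"
    have N: "?N l I = (\<Sum>i\<in>?R. ?n l i)"
      using window_count_split[OF fin \<open>t > 0\<close>, of f g w l I] by simp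
    have "(\<Sum>i\<in>?R. (?n l i - ?N l (i div t) / t)\<^sup>2 / w) = (\<Sum>i\<in>?R. (?n l i - ?N l I / t)\<^sup>2 / w)"
    proof (rule sum.cong)
      fix i assume "i \<in> ?R"
      then have "i div t = I" by (intro div_nat_eqI) (auto simp: algebra_simps)
      then show "(?n l i - ?N l (i div t) / t)\<^sup>2 / w = (?n l i - ?N l I / t)\<^sup>2 / w" by simp
    qed simp
    also have "\<dots> = (\<Sum>i\<in>?R. (?n l i)\<^sup>2 / w - 2 * (?N l I / t) / w * ?n l i + (?N l I / t)\<^sup>2 / w)"
      by (intro sum.cong refl) (simp add: power2_diff diff_divide_distrib add_divide_distrib)
    also have "\<dots> = (\<Sum>i\<in>?R. (?n l i)\<^sup>2 / w) - 2 * (?N l I / t) / w * ?N l I + t * ((?N l I / t)\<^sup>2 / w)"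
      unfolding N by (simp add: sum.distrib sum_subtractf sum_distrib_left)
    also have "\<dots> = (\<Sum>i\<in>?R. (?n l i)\<^sup>2 / w) - (?N l I)\<^sup>2 / real (w * t)"
      using assms by (simp add: field_simps power2_eq_square)
    finally show ?thesis by simp
  qed
  show ?thesis
    unfolding energy_def Lw sum_lessThan_mult block[symmetric] m_def[symmetric]
    by (simp add: sum_subtractf)
qed

lemma energy_antimono:
  assumes "finite S" "w > 0" "t > 0" "w * t dvd L"
  shows "energy S f g L (w * t) \<le> energy S f g L w"
proof -
  have "0 \<le> energy S f g L w - energy S f g L (w * t)"
    unfolding energy_diff[OF assms] by (intro sum_nonneg) auto
  then show ?thesis by simp
qed

lemma finite_gaps: "finite (gaps S T f g L w t K)"
  by (rule finite_subset[of _ "{..<L} \<times> {..<L div w}"]) (auto simp: gaps_def)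

text \<open>An empty window in a dense block either deviates from the mean of its block, which costs
  energy, or all of its many points of \<open>S\<close> lie outside \<open>T\<close>.\<close>

lemma card_gaps_le:
  assumes fin: "finite S" and "w > 0" "t > 0" "w * t dvd L" "K > 0"
  shows "real (card (gaps S T f g L w t K)) \<le>
    (energy S f g L w - energy S f g L (w * t)) * w * (2 * t / K)\<^sup>2 + real (card (S - T)) * (2 * t / K)"
proof -
  let ?G = "gaps S T f g L w t K"
  let ?n = "\<lambda>l i. real (window_count S f g w l i)"
  let ?N = "\<lambda>l I. real (window_count S f g (w * t) l I)"
  \<comment> \<open>Half of \<open>K / t\<close>, the least possible mean count per window in a
    dense block. \<open>G1\<close> collects the windows far below the mean, \<open>G2\<close> those
    whose many points of \<open>S\<close> all lie outside \<open>T\<close>.\<close>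
  define c where "c = real K / (2 * t)"
  have c: "c > 0" using assms by (simp add: c_def)
  define G1 where "G1 = {e\<in>?G. ?n (fst e) (snd e) < c}"
  define G2 where "G2 = {e\<in>?G. c \<le> ?n (fst e) (snd e)}"
  have finG: "finite ?G" "finite G1" "finite G2"
    using finite_gaps[of S T f g L w t K] by (auto simp: G1_def G2_def)
  have "?G = G1 \<union> G2" "G1 \<inter> G2 = {}" by (auto simp: G1_def G2_def)
  then have cG: "real (card ?G) = card G1 + card G2"
    using card_Un_disjoint[OF finG(2,3)] by simp
  let ?d = "\<lambda>(l, i). (?n l i - ?N l (i div t) / t)\<^sup>2 / w"
  have "card G1 * (c\<^sup>2 / w) = (\<Sum>e\<in>G1. c\<^sup>2 / w)" by simp
  also have "\<dots> \<le> (\<Sum>e\<in>G1. ?d e)"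
  proof (rule sum_mono)
    fix e assume e: "e \<in> G1"
    obtain l i where li: "e = (l, i)" by force
    have "real K \<le> ?N l (i div t)" using e li by (auto simp: G1_def gaps_def)
    then have "2 * c \<le> ?N l (i div t) / t"
      unfolding c_def using assms by (simp add: divide_right_mono)
    moreover have "?n l i < c" using e li by (auto simp: G1_def)
    ultimately have "c \<le> ?N l (i div t) / t - ?n l i" by simp
    then have "c\<^sup>2 \<le> (?N l (i div t) / t - ?n l i)\<^sup>2" using c by (intro power_mono) auto
    then show "c\<^sup>2 / w \<le> ?d e" using li by (simp add: power2_commute divide_right_mono)
  qed
  also have "\<dots> \<le> (\<Sum>e\<in>{..<L} \<times> {..<L div w}. ?d e)"
    by (rule sum_mono2) (auto simp: G1_def gaps_def)
  also have "\<dots> = energy S f g L w - energy S f g L (w * t)"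
    unfolding energy_diff[OF assms(1-4)] by (simp add: sum.cartesian_product)
  finally have 1: "card G1 \<le> (energy S f g L w - energy S f g L (w * t)) * w * (1 / c)\<^sup>2"
    using c assms by (simp add: field_simps power2_eq_square)
  have "card G2 * c = (\<Sum>e\<in>G2. c)" by simp
  also have "\<dots> \<le> (\<Sum>e\<in>G2. ?n (fst e) (snd e))"
    by (rule sum_mono) (auto simp: G2_def)
  also have "\<dots> = real (card (\<Union>e\<in>G2. {p\<in>S. f p = fst e \<and> g p div w = snd e}))"
    unfolding window_count_def of_nat_sum[symmetric]
    by (subst card_UN_disjoint) (use fin finG in auto)
  also have "\<dots> \<le> real (card (S - T))"
    using fin by (intro of_nat_mono card_mono) (auto simp: G2_def gaps_def)
  finally have 2: "card G2 \<le> real (card (S - T)) * (1 / c)"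
    using c by (simp add: field_simps)
  show ?thesis using 1 2 cG by (simp add: c_def)
qed

lemma div_mult_of_window:
  assumes "a div w = (b::nat)" "q = w * t"
  shows "b div t = a div q"
  using assms by (simp add: div_mult2_eq)

lemma same_block_less:
  assumes "a div q = b div (q::nat)" "q > 0"
  shows "a < b + q"
proof -
  have "a < q + a div q * q" using dividend_less_div_times[OF assms(2)] .
  moreover have "b div q * q \<le> b" by simp
  ultimately show ?thesis unfolding assms(1) by linarith
qed

lemma card_windows_ge:
  assumes A: "finite A" "N * w \<le> card A" "w > 0" and inj: "inj_on g A"
  shows "N \<le> card ((\<lambda>a. g a div w) ` A)"
proof -
  have "card {a\<in>A. g a div w = i} \<le> w" for i
  proof -
    have "inj_on (\<lambda>a. g a mod w) {a\<in>A. g a div w = i}"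
      by (rule inj_onI) (metis (mono_tags, lifting) div_mult_mod_eq inj inj_onD mem_Collect_eq)
    moreover have "(\<lambda>a. g a mod w) ` {a\<in>A. g a div w = i} \<subseteq> {..<w}" using \<open>w > 0\<close> by auto
    ultimately show ?thesis using card_inj_on_le[of "\<lambda>a. g a mod w" _ "{..<w}"] by fastforce
  qed
  moreover have "A = (\<Union>i\<in>(\<lambda>a. g a div w) ` A. {a\<in>A. g a div w = i})" by auto
  ultimately have "card A \<le> (\<Sum>i\<in>(\<lambda>a. g a div w) ` A. w)"
    using card_UN_le[of "(\<lambda>a. g a div w) ` A" "\<lambda>i. {a\<in>A. g a div w = i}"] A
    by (metis (mono_tags, lifting) finite_imageI order_trans sum_mono)
  then have "N * w \<le> card ((\<lambda>a. g a div w) ` A) * w"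
    by (intro order_trans[OF A(2)]) simp
  then show ?thesis using A by simp
qed

section \<open>Branching windows\<close>

text \<open>Columns are the fibres of \<open>px\<close>, rows those of \<open>py\<close> and level
  sets those of \<open>pz\<close>; \<open>pz\<close> is thought of as a height over the
  \<open>(px, py)\<close> plane.\<close>

locale chain_system =
  fixes S :: "'a set" and px py pz :: "'a \<Rightarrow> nat" and L :: nat
  assumes fin: "finite S"
    and bound: "p \<in> S \<Longrightarrow> px p < L \<and> py p < L \<and> pz p < L"
    and chx: "chain_fibres S px py pz"
    and chy: "chain_fibres S py px pz"
    and chz: "chain_fibres S pz px py"
begin

text \<open>Over the window \<open>(i, j)\<close>, the tree of nested blocks of heights splits
  between the scales \<open>Q\<close> and \<open>v\<close>. Splittings at successive scales can
  therefore be summed against the number of leaves.\<close>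

definition branching :: "'a set \<Rightarrow> nat \<Rightarrow> nat \<Rightarrow> nat \<Rightarrow> (nat \<times> nat) set" where
  "branching T w v Q = {(i, j). \<exists>p\<in>T. \<exists>r\<in>T. px p div w = i \<and> px r div w = i \<and>
     py p div w = j \<and> py r div w = j \<and> pz p div Q = pz r div Q \<and> pz p div v \<noteq> pz r div v}"

text \<open>The staircase from \<open>p0\<close> along its row to \<open>r\<close> and up the column of \<open>r\<close> raises \<open>pz\<close> by more
  than \<open>v\<close>, whereas the chain of constant \<open>pz\<close> through \<open>p0\<close> followed by a step down the column of
  \<open>p1\<close> does not raise it; both arrive in the same window.\<close>

lemma staircase_branching:
  assumes sub: "S1 \<subseteq> S0" "S0 \<subseteq> S" "p0 \<in> S" "p1 \<in> S1" "r \<in> S1"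
    and pos: "w > 0" "v > 0" "q = w * t" "t > 0" 
    and up: "q \<le> card {a\<in>S. px a = px r \<and> py a div Q = py r div Q \<and> pz a div Q = pz r div Q \<and> py r < py a}"
    and down: "q \<le> card {a\<in>S. px a = px p1 \<and> py a div Q = py p1 div Q \<and> pz a div Q = pz p1 div Q \<and> py a < py p1}"
    and row_up: "q \<le> card {a\<in>S. py a = py p0 \<and> px a div Q = px p0 div Q \<and> pz a div Q = pz p0 div Q \<and> px p0 < px a}"
    and near: "v \<le> card {a\<in>S. py a = py p0 \<and> px p0 < px a \<and> px a < px p0 + q2}"
    and p1: "pz p1 = pz p0" "px p1 div q = px p0 div q" "py p1 div q = py p0 div q"
      "px p0 + q2 + w \<le> px p1"
    and r: "py r = py p0" "px r div w = px p1 div w"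
    and j: "py p0 div w < j" "j < py p1 div w"
    and p1': "p1' \<in> S0" "px p1' = px p1" "py p1' div w = j"
    and r2: "r2 \<in> S0" "px r2 = px r" "py r2 div w = j"
  shows "(px p1 div w, j) \<in> branching S0 w v Q"
proof -
  have inS: "p0 \<in> S" "p1 \<in> S" "r \<in> S" "p1' \<in> S" "r2 \<in> S" using sub p1' r2 by auto
  have qpos: "q > 0" using pos by simp
  have rq: "px r div q = px p0 div q"
    using div_mult_of_window[OF r(2) pos(3)] div_mult_of_window[OF refl pos(3), of "px p1"] p1 by simp
  have xr: "px p0 + q2 \<le> px r"
    using same_block_less[of "px p1" w "px r"] r pos p1 by simp
  have xr': "px r < px p0 + q" using same_block_less[OF rq qpos] .
  have "\<exists>a\<in>S. py a = py p0 \<and> px p0 < px a \<and> px a < px p0 + q2"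
  proof (rule ccontr)
    assume "\<not> ?thesis"
    then have "{a\<in>S. py a = py p0 \<and> px p0 < px a \<and> px a < px p0 + q2} = {}" by blast
    then show False using near pos by (metis card.empty not_le)
  qed
  then have xr0: "px p0 < px r" using xr by auto
  have zr: "pz r div Q = pz p0 div Q"
    by (rule chain_reach_up[OF chy inS(1,3) r(1) xr0 xr' row_up])
  \<comment> \<open>The points supplied by \<open>near\<close> lie in the row strictly between
    \<open>p0\<close> and \<open>r\<close>, and their heights are distinct; this is where the rise
    of more than \<open>v\<close> comes from.\<close>
  let ?N = "{a\<in>S. py a = py p0 \<and> px p0 < px a \<and> px a < px p0 + q2}"
  have "card ?N \<le> card {pz p0<..<pz r}"
  proof (rule card_inj_on_le)
    show "inj_on pz ?N"
      by (rule inj_onI) (use chain_fibresD(3)[OF chy] in auto)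
    show "pz ` ?N \<subseteq> {pz p0<..<pz r}"
    proof
      fix z assume "z \<in> pz ` ?N"
      then obtain a where a: "a \<in> ?N" "z = pz a" by auto
      then have "pz p0 < pz a" "pz a < pz r"
        using chain_fibresD(1)[OF chy, of p0 a] chain_fibresD(1)[OF chy, of a r] inS r xr by auto
      then show "z \<in> {pz p0<..<pz r}" using a by simp
    qed
  qed simp
  then have zr_lo: "pz p0 + v < pz r" using near pos by simp
  have jq: "j div t = py p0 div q"
  proof -
    have "py p0 div w div t \<le> j div t" "j div t \<le> py p1 div w div t"
      using j by (auto intro: div_le_mono)
    then show ?thesis using p1 pos by (simp add: div_mult2_eq)
  qed
  have lt: "py p0 < py a" "py a < py p1" if "py a div w = j" for a
    using j that div_le_mono[of "py a" "py p0" w] div_le_mono[of "py p1" "py a" w]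
    by (force simp: not_le[symmetric])+
  have "py r2 < py r + q"
    using div_mult_of_window[OF r2(3) pos(3)] jq r same_block_less[of "py r2" q "py r"] qpos by simp
  then have zr2: "pz r2 div Q = pz r div Q"
    using chain_reach_up[OF chx inS(3,5) r2(2) _ _ up] lt[OF r2(3)] r by simp
  have zr2_lo: "pz r < pz r2"
    using chain_fibresD(1)[OF chx inS(3,5)] r2 lt[OF r2(3)] r by simp
  have "py p1 < py p1' + q"
    using div_mult_of_window[OF p1'(3) pos(3)] jq p1 same_block_less[of "py p1" q "py p1'"] qpos by simp
  then have zp: "pz p1' div Q = pz p1 div Q"
    using chain_reach_down[OF chx inS(2,4) p1'(2) _ _ down] lt[OF p1'(3)] by simp
  have zp_hi: "pz p1' < pz p1"
    using chain_fibresD(1)[OF chx inS(4,2)] p1' lt[OF p1'(3)] by simp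
  \<comment> \<open>The final column moves only widen the difference: \<open>p1'\<close> is below
    the level shared by \<open>p0\<close> and \<open>p1\<close>, and \<open>r2\<close> is above
    \<open>r\<close>.\<close>
  have "pz p1' + v < pz r2" using zp_hi zr2_lo zr_lo p1 by linarith
  then have "pz p1' div v \<noteq> pz r2 div v"
    using same_block_less[of "pz r2" v "pz p1'"] pos by auto
  moreover have "pz p1' div Q = pz r2 div Q" using zp zr2 zr p1 by simp
  ultimately show ?thesis unfolding branching_def using p1' r2 r
    by (simp only: mem_Collect_eq case_prod_conv) (rule bexI[of _ p1'], rule bexI[of _ r2], auto)
qed

text \<open>Each endpoint \<open>p1\<close> on the level set of \<open>p0\<close> gives staircases
  to all windows between the two rows. At least \<open>16 * m\<close> column windows are reached, of
  which \<open>8 * m\<close> survive the gaps of the row; each of them gives \<open>4 * m\<close>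
  windows \<open>j\<close>, after the gaps of the two columns are removed.\<close>

lemma branching_cells_near:
  assumes sub: "S1 \<subseteq> S0" "S0 \<subseteq> S" "p0 \<in> S"
    and pos: "w > 0" "v > 0" "m > 0" "q = w * t" "t > 0" and wL: "w dvd L"
    and up: "\<And>p. p \<in> S1 \<Longrightarrow>
      q \<le> card {a\<in>S. px a = px p \<and> py a div Q = py p div Q \<and> pz a div Q = pz p div Q \<and> py p < py a}"
    and down: "\<And>p. p \<in> S1 \<Longrightarrow>
      q \<le> card {a\<in>S. px a = px p \<and> py a div Q = py p div Q \<and> pz a div Q = pz p div Q \<and> py a < py p}"
    and col: "\<And>p j. p \<in> S1 \<Longrightarrow> j < L div w \<Longrightarrow> j div t = py p div q \<Longrightarrow> (px p, j) \<notin> Gc \<Longrightarrow>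
      \<exists>r\<in>S0. px r = px p \<and> py r div w = j"
    and colg: "\<And>p. p \<in> S1 \<Longrightarrow> card {j. j div t = py p div q \<and> (px p, j) \<in> Gc} \<le> m"
    and row_up: "q \<le> card {a\<in>S. py a = py p0 \<and> px a div Q = px p0 div Q \<and> pz a div Q = pz p0 div Q \<and> px p0 < px a}"
    and zch: "32 * m * w \<le> card {a\<in>S1. pz a = pz p0 \<and> px a div q = px p0 div q \<and> py a div q = py p0 div q \<and> px p0 < px a}"
    and near: "v \<le> card {a\<in>S. py a = py p0 \<and> px p0 < px a \<and> px a < px p0 + q2}"
    and row: "\<And>i. i < L div w \<Longrightarrow> i div t = px p0 div q \<Longrightarrow> (py p0, i) \<notin> Gr \<Longrightarrow>
      \<exists>r\<in>S1. py r = py p0 \<and> px r div w = i"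
    and rowg: "card {i. i div t = px p0 div q \<and> (py p0, i) \<in> Gr} \<le> 8 * m"
    and finG: "finite Gc" "finite Gr" and q2: "q2 + w \<le> 8 * m * w"
  shows "32 * m\<^sup>2 \<le> card {(i, j). (i, j) \<in> branching S0 w v Q \<and> i div t = px p0 div q \<and> j div t = py p0 div q}"
    (is "_ \<le> card ?C")
proof -
  have finS: "finite S0" "finite S1" using fin sub by (auto intro: finite_subset)
  define A where "A = {a\<in>S1. pz a = pz p0 \<and> px a div q = px p0 div q \<and> py a div q = py p0 div q \<and> px p0 < px a}"
  \<comment> \<open>Separation in \<open>px\<close> leaves room for the \<open>v\<close> row points
    before \<open>r\<close>; separation in \<open>py\<close> leaves about \<open>8 * m\<close>
    windows between the rows. Each requirement discards at most \<open>8 * m * w\<close> points,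
    since both coordinates are injective on \<open>A\<close>.\<close>
  define A' where "A' = {a\<in>A. px p0 + 8 * m * w \<le> px a \<and> py p0 + 8 * m * w \<le> py a}"
  have finA: "finite A" using finS by (simp add: A_def)
  have AS: "A \<subseteq> S" using sub by (auto simp: A_def)
  have Az: "pz a = pz p0" "px p0 < px a" "a \<in> S1" if "a \<in> A" for a using that by (auto simp: A_def)
  have injx: "inj_on px A"
    by (rule inj_onI, rule chain_fibresD(2)[OF chz]) (use Az AS in auto)
  have injy: "inj_on py A"
    by (rule inj_onI, rule chain_fibresD(3)[OF chz]) (use Az AS in auto)
  have yA: "py p0 < py a" if "a \<in> A" for a
    using chain_fibresD(1)[OF chz, of p0 a] Az[OF that] AS that sub by auto
  have "A \<subseteq> A' \<union> ({a\<in>A. px a < px p0 + 8 * m * w} \<union> {a\<in>A. py a < py p0 + 8 * m * w})"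
    by (auto simp: A'_def)
  then have "card A \<le> card A' + card ({a\<in>A. px a < px p0 + 8 * m * w} \<union> {a\<in>A. py a < py p0 + 8 * m * w})"
    by (intro order_trans[OF card_mono card_Un_le]) (use finA in \<open>auto simp: A'_def\<close>)
  moreover have "card {a\<in>A. px a < px p0 + 8 * m * w} \<le> card {px p0<..<px p0 + 8 * m * w}"
    by (rule card_inj_on_le[of px]) (use injx in \<open>auto intro: inj_on_subset dest: Az(2)\<close>)
  moreover have "card {a\<in>A. py a < py p0 + 8 * m * w} \<le> card {py p0<..<py p0 + 8 * m * w}"
    by (rule card_inj_on_le[of py]) (use injy in \<open>auto intro: inj_on_subset dest: yA\<close>)
  ultimately have cA': "16 * m * w \<le> card A'"
    using zch card_Un_le[of "{a\<in>A. px a < px p0 + 8 * m * w}" "{a\<in>A. py a < py p0 + 8 * m * w}"]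
    unfolding A_def[symmetric] by simp
  have A'A: "A' \<subseteq> A" by (auto simp: A'_def)
  define W where "W = (\<lambda>a. px a div w) ` A' - {i. i div t = px p0 div q \<and> (py p0, i) \<in> Gr}"
  have cW: "8 * m \<le> card W"
  proof -
    have "16 * m \<le> card ((\<lambda>a. px a div w) ` A')"
      using cA' finA A'A injx pos by (intro card_windows_ge) (auto intro: finite_subset inj_on_subset)
    moreover have "finite {i. i div t = px p0 div q \<and> (py p0, i) \<in> Gr}"
      by (rule finite_subset[OF _ finite_imageI[OF finG(2), of snd]]) force
    ultimately show ?thesis unfolding W_def
      using rowg diff_card_le_card_Diff[of "{i. i div t = px p0 div q \<and> (py p0, i) \<in> Gr}" "(\<lambda>a. px a div w) ` A'"]
      by linarith
  qed
  have finW: "finite W" unfolding W_def using finA A'A by (auto intro: finite_subset)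
  have divL: "a div w < L div w" if "a < L" for a by (rule div_less_div[OF wL pos(1) that])
  have "\<exists>J. finite J \<and> 4 * m \<le> card J \<and> (\<forall>j\<in>J. (i, j) \<in> ?C)" if i: "i \<in> W" for i
  proof -
    obtain p1 where p1: "p1 \<in> A'" "i = px p1 div w" using i by (auto simp: W_def)
    have p1A: "p1 \<in> A" "p1 \<in> S1" "p1 \<in> S" using p1 A'A AS Az by auto
    have p1q: "px p1 div q = px p0 div q" "py p1 div q = py p0 div q" using p1A by (auto simp: A_def)
    have iq: "i div t = px p0 div q" using div_mult_of_window[OF p1(2)[symmetric] pos(4)] p1q by simp
    have "i < L div w" using divL bound p1 p1A by blast
    then obtain r where r: "r \<in> S1" "py r = py p0" "px r div w = i"
      using row[OF _ iq] i iq by (auto simp: W_def)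
    define B where "B = (\<lambda>p. {j. j div t = py p div q \<and> (px p, j) \<in> Gc})"
    have finB: "finite (B p)" for p
      unfolding B_def by (rule finite_subset[OF _ finite_imageI[OF finG(1), of snd]]) force
    define J where "J = {py p0 div w<..<py p1 div w} - (B p1 \<union> B r)"
    have "py p0 + 8 * m * w \<le> py p1" using p1 by (auto simp: A'_def)
    then have "(py p0 + 8 * m * w) div w \<le> py p1 div w" by (rule div_le_mono)
    \<comment> \<open>Both end windows are excluded, hence the \<open>- 1\<close>. Removing
      \<open>2 * m\<close> gaps still leaves \<open>4 * m\<close> windows because
      \<open>m > 0\<close>.\<close>
    then have "8 * m - 1 \<le> card {py p0 div w<..<py p1 div w}"
      using pos by simp
    moreover have "card (B p1 \<union> B r) \<le> 2 * m"
      using colg[OF p1A(2)] colg[OF r(1)] card_Un_le[of "B p1" "B r"] by (simp add: B_def)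
    ultimately have cJ: "4 * m \<le> card J"
      unfolding J_def using diff_card_le_card_Diff[of "B p1 \<union> B r" "{py p0 div w<..<py p1 div w}"] finB pos
      by (simp del: card_greaterThanLessThan)
    have "(i, j) \<in> ?C" if j: "j \<in> J" for j
    proof -
      have jj: "py p0 div w < j" "j < py p1 div w" using j by (auto simp: J_def)
      have jq: "j div t = py p0 div q"
      proof -
        have "py p0 div w div t \<le> j div t" "j div t \<le> py p1 div w div t"
          using jj by (auto intro: div_le_mono)
        then show ?thesis using p1q pos by (simp add: div_mult2_eq)
      qed
      have "j < L div w" using jj divL bound[OF p1A(3)] by (meson less_trans)
      moreover have "(px p1, j) \<notin> Gc" "(px r, j) \<notin> Gc" using j jq p1q r by (auto simp: J_def B_def)
      ultimately obtain p1' r2 where "p1' \<in> S0" "px p1' = px p1" "py p1' div w = j"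
        "r2 \<in> S0" "px r2 = px r" "py r2 div w = j"
        using col[OF p1A(2), of j] col[OF r(1), of j] jq p1q r by metis
      moreover have "px p0 + q2 + w \<le> px p1" using p1 q2 by (auto simp: A'_def)
      ultimately have "(px p1 div w, j) \<in> branching S0 w v Q"
        using staircase_branching[OF sub p1A(2) r(1) pos(1,2,4,5) up[OF r(1)] down[OF p1A(2)] row_up near
            Az(1)[OF p1A(1)] p1q _ r(2) _ jj, of p1' r2] r p1 by auto
      then show ?thesis using iq jq p1 by simp
    qed
    then show ?thesis using cJ by (intro exI[of _ J]) (auto simp: J_def)
  qed
  then have "\<forall>i\<in>W. \<exists>J. finite J \<and> 4 * m \<le> card J \<and> (\<forall>j\<in>J. (i, j) \<in> ?C)" ..
  from bchoice[OF this] obtain J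
    where J: "\<And>i. i \<in> W \<Longrightarrow> finite (J i) \<and> 4 * m \<le> card (J i) \<and> (\<forall>j\<in>J i. (i, j) \<in> ?C)"
    by (elim exE) (rule that, erule (1) bspec)
  have "8 * m * (4 * m) \<le> card W * (4 * m)" using cW by simp
  also have "\<dots> = (\<Sum>i\<in>W. 4 * m)" by simp
  also have "\<dots> \<le> (\<Sum>i\<in>W. card (J i))" using J by (intro sum_mono) blast
  also have "\<dots> = card (Sigma W J)" using finW J by (subst card_SigmaI) auto
  also have "\<dots> \<le> card ?C"
  proof (rule card_mono)
    have "branching S0 w v Q \<subseteq> (\<lambda>p. (px p div w, py p div w)) ` S0" by (auto simp: branching_def)
    then have "finite (branching S0 w v Q)" using finS by (meson finite_imageI finite_subset)
    then show "finite ?C" by (rule finite_subset[rotated]) auto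
    show "Sigma W J \<subseteq> ?C"
      by (rule subsetI, erule SigmaE) (use J in blast)
  qed
  finally show ?thesis by (simp add: power2_eq_square)
qed

end

section \<open>Counting exceptional points\<close>

lemma chain_fibres_subset:
  "chain_fibres S f g h \<Longrightarrow> T \<subseteq> S \<Longrightarrow> chain_fibres T f g h"
  unfolding chain_fibres_def by blast

text \<open>A chain runs through few pairs of blocks, and only the top \<open>k\<close> points of
  each piece can be exceptional.\<close>

lemma card_few_above_le:
  assumes ch: "chain_fibres S f g h" and fin: "finite S" and u: "u > 0" "u dvd L"
    and bd: "\<And>p. p \<in> S \<Longrightarrow> f p < L \<and> g p < L \<and> h p < L"
  shows "card {p\<in>S. card {a\<in>S. f a = f p \<and> g a div u = g p div u \<and> h a div u = h p div u \<and> g p < g a} < k}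
    \<le> k * (2 * L * (L div u))"
proof -
  let ?key = "\<lambda>p. (f p, g p div u, h p div u)"
  have "card {p\<in>S. card {a\<in>S. ?key a = ?key p \<and> int (g p) < int (g a)} < k} \<le> k * card (?key ` S)"
    by (rule card_low_rank_le[OF fin]) (use chain_fibresD(2)[OF ch] in auto)
  also have "\<dots> \<le> k * (2 * L * (L div u))"
    by (intro mult_le_mono2 card_pieces_le[OF ch u bd])
  finally show ?thesis by (simp add: conj_assoc)
qed

lemma card_few_below_le:
  assumes ch: "chain_fibres S f g h" and fin: "finite S" and u: "u > 0" "u dvd L"
    and bd: "\<And>p. p \<in> S \<Longrightarrow> f p < L \<and> g p < L \<and> h p < L"
  shows "card {p\<in>S. card {a\<in>S. f a = f p \<and> g a div u = g p div u \<and> h a div u = h p div u \<and> g a < g p} < k}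
    \<le> k * (2 * L * (L div u))"
proof -
  let ?key = "\<lambda>p. (f p, g p div u, h p div u)"
  \<comment> \<open>Negated ranks turn the count of points above into a count of points
    below.\<close>
  have "card {p\<in>S. card {a\<in>S. ?key a = ?key p \<and> - int (g p) < - int (g a)} < k} \<le> k * card (?key ` S)"
    by (rule card_low_rank_le[OF fin]) (use chain_fibresD(2)[OF ch] in auto)
  also have "\<dots> \<le> k * (2 * L * (L div u))"
    by (intro mult_le_mono2 card_pieces_le[OF ch u bd])
  finally show ?thesis by (simp add: conj_assoc)
qed

lemma card_windows_le:
  assumes u: "u > 0" "u dvd L" and bd: "\<And>p. p \<in> S \<Longrightarrow> f p < L \<and> g p < L"
  shows "card ((\<lambda>p. (f p, g p div u)) ` S) \<le> L * (L div u)"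
proof -
  have "card ((\<lambda>p. (f p, g p div u)) ` S) \<le> card ({..<L} \<times> {..<L div u})"
    using bd div_less_div[OF u(2,1)] by (intro card_mono) auto
  then show ?thesis by simp
qed

lemma card_few_above_window_le:
  assumes inj: "\<And>p r. p \<in> S \<Longrightarrow> r \<in> S \<Longrightarrow> f p = f r \<Longrightarrow> g p = g r \<Longrightarrow> p = r"
    and fin: "finite S" and u: "u > 0" "u dvd L"
    and bd: "\<And>p. p \<in> S \<Longrightarrow> f p < L \<and> g p < L"
  shows "card {p\<in>S. card {a\<in>S. f a = f p \<and> g a div u = g p div u \<and> g p < g a} < k} \<le> k * (L * (L div u))"
proof -
  let ?key = "\<lambda>p. (f p, g p div u)"
  have "card {p\<in>S. card {a\<in>S. ?key a = ?key p \<and> int (g p) < int (g a)} < k} \<le> k * card (?key ` S)"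
    by (rule card_low_rank_le[OF fin]) (use inj in auto)
  also have "\<dots> \<le> k * (L * (L div u))"
    by (intro mult_le_mono2 card_windows_le[OF u bd])
  finally show ?thesis by (simp add: conj_assoc)
qed

lemma card_sparse_window_le:
  assumes fin: "finite S" and u: "u > 0" "u dvd L"
    and bd: "\<And>p. p \<in> S \<Longrightarrow> f p < L \<and> g p < L"
  shows "card {p\<in>S. window_count S f g u (f p) (g p div u) < k} \<le> k * (L * (L div u))"
proof -
  let ?key = "\<lambda>p. (f p, g p div u)"
  have "card {p\<in>S. card {a\<in>S. ?key a = ?key p} < k} \<le> k * card (?key ` S)"
    by (rule card_light_le[OF fin])
  also have "\<dots> \<le> k * (L * (L div u))"
    by (intro mult_le_mono2 card_windows_le[OF u bd])
  finally show ?thesis by (simp add: window_count_def)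
qed

text \<open>Double counting: a bad block uses up more than \<open>m\<close> elements of
  \<open>G\<close>, distinct blocks use distinct elements, and a block holds at most
  \<open>q\<close> points.\<close>

lemma card_many_gaps_le:
  fixes f g :: "'a \<Rightarrow> nat"
  assumes inj: "\<And>p r. p \<in> S \<Longrightarrow> r \<in> S \<Longrightarrow> f p = f r \<Longrightarrow> g p = g r \<Longrightarrow> p = r"
    and fin: "finite S" "finite G" and q: "q > 0"
  shows "m * card {p\<in>S. m < card {i. i div t = g p div q \<and> (f p, i) \<in> G}} \<le> q * card G"
proof -
  let ?c = "\<lambda>(l, J). {i. i div t = J \<and> (l, i) \<in> G}"
  let ?bad = "{p\<in>S. m < card (?c (f p, g p div q))}"
  define B where "B = (\<lambda>p. (f p, g p div q)) ` ?bad"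
  have finB: "finite B" using fin by (simp add: B_def)
  have finc: "finite (?c b)" for b
    by (rule finite_subset[OF _ finite_imageI[OF fin(2), of snd]]) (force split: prod.splits)
  have "m * card B = (\<Sum>b\<in>B. m)" by simp
  also have "\<dots> \<le> (\<Sum>b\<in>B. card (?c b))"
    by (intro sum_mono) (auto simp: B_def)
  also have "\<dots> = (\<Sum>b\<in>B. card (Pair (fst b) ` ?c b))"
    by (intro sum.cong refl card_image[symmetric]) (auto simp: inj_on_def)
  also have "\<dots> = card (\<Union>b\<in>B. Pair (fst b) ` ?c b)"
    by (subst card_UN_disjoint) (use finB finc in auto)
  also have "\<dots> \<le> card G" using fin by (intro card_mono) auto
  finally have mB: "m * card B \<le> card G" .
  have "card ?bad = card (\<Union>b\<in>B. {p\<in>?bad. (f p, g p div q) = b})"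
    by (rule arg_cong[where f=card]) (auto simp: B_def)
  also have "\<dots> \<le> (\<Sum>b\<in>B. card {p\<in>?bad. (f p, g p div q) = b})"
    by (rule card_UN_le[OF finB])
  also have "\<dots> \<le> (\<Sum>b\<in>B. q)"
  proof (rule sum_mono)
    fix b
    have "card {p\<in>?bad. (f p, g p div q) = b} \<le> window_count S f g q (fst b) (snd b)"
      unfolding window_count_def using fin by (intro card_mono) auto
    also have "\<dots> \<le> q" by (rule window_count_le[OF q inj])
    finally show "card {p\<in>?bad. (f p, g p div q) = b} \<le> q" .
  qed
  finally have "card ?bad \<le> q * card B" by (simp add: mult.commute)
  then have "m * card ?bad \<le> m * (q * card B)" by (rule mult_le_mono2)
  also have "\<dots> = q * (m * card B)" by simp
  also have "\<dots> \<le> q * card G" using mB by (rule mult_le_mono2)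
  finally show ?thesis by simp
qed

section \<open>Typical points and the number of branching windows\<close>

context chain_system
begin

lemma inj_xy: "p \<in> S \<Longrightarrow> r \<in> S \<Longrightarrow> px p = px r \<Longrightarrow> py p = py r \<Longrightarrow> p = r"
  by (rule chain_fibresD(2)[OF chx])

lemma card_block_le:
  assumes "q > 0"
  shows "card {p\<in>S. px p div q = I \<and> py p div q = J} \<le> q\<^sup>2"
proof -
  let ?A = "{p\<in>S. px p div q = I \<and> py p div q = J}"
  let ?f = "\<lambda>p. (px p mod q, py p mod q)"
  have "inj_on ?f ?A"
  proof (rule inj_onI)
    fix p r assume *: "p \<in> ?A" "r \<in> ?A" "?f p = ?f r"
    then have "px p = px r" "py p = py r" by (metis (mono_tags, lifting) div_mult_mod_eq mem_Collect_eq prod.inject)+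
    then show "p = r" using inj_xy * by blast
  qed
  moreover have "?f ` ?A \<subseteq> {..<q} \<times> {..<q}" using assms by auto
  ultimately have "card ?A \<le> card ({..<q} \<times> {..<q})" by (intro card_inj_on_le) auto
  then show ?thesis by (simp add: power2_eq_square)
qed

lemma finite_branching: "T \<subseteq> S \<Longrightarrow> finite (branching T w v Q)"
proof -
  assume "T \<subseteq> S"
  then have "branching T w v Q \<subseteq> (\<lambda>p. (px p div w, py p div w)) ` S" by (auto simp: branching_def)
  then show ?thesis using fin by (meson finite_imageI finite_subset)
qed

text \<open>At least \<open>L^2 / (2 * D)\<close> points satisfy the hypotheses of
  \<open>branching_cells_near\<close>, and each sees \<open>32 * m^2\<close> branching windows in
  its block of side \<open>q\<close>. A window is seen from at most \<open>q^2\<close> points. The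
  scales are \<open>v\<close> for the rise, \<open>q2\<close> for the row segment achieving it,
  \<open>q\<close> for the staircase and \<open>Q\<close> for confining the heights.\<close>

lemma branching_cells_lower_bound:
  fixes \<eta> \<sigma>0 \<sigma> :: real and D m w t q q2 Q R C v kc :: nat
  assumes S0: "S0 \<subseteq> S" and dense: "(real L)\<^sup>2 \<le> D * real (card S)"
    and pos: "w > 0" "v > 0" "m > 0" "D > 0" "R > 0" "C > 0"
    and q: "q = w * t" "t = 1024 * D * m" and Q: "Q = q * R" "Q dvd L"
    and q2: "q2 dvd L" "16 * D * v \<le> q2" "q2 + w \<le> 8 * m * w" and kc: "kc * C = q"
    and ex: "energy S px py L w - energy S px py L q \<le> \<eta> * (real L)\<^sup>2"
    and ey: "energy S py px L w - energy S py px L q \<le> \<eta> * (real L)\<^sup>2"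
    and loss: "real (card (S - S0)) \<le> \<sigma>0 * (real L)\<^sup>2"
    and \<sigma>: "\<sigma>0 + 4 / R + 1 / C + (4 * \<eta> * (real C)\<^sup>2 + 2 * \<sigma>0 * C) * (1024 * D) \<le> \<sigma>"
    and small: "2 / R + \<sigma> + 3 / (16 * D) + 131072 * real D ^ 3 * \<eta> + 4096 * (real D)\<^sup>2 * \<sigma> \<le> 1 / (2 * D)"
  shows "(real L)\<^sup>2 \<le> 65536 * real D ^ 3 * (real w)\<^sup>2 * card (branching S0 w v Q)"
proof (cases "L = 0")
  case False
  define l2 where "l2 = (real L)\<^sup>2"
  have l2: "l2 > 0" using False by (simp add: l2_def)
  have tpos: "t > 0" and qpos: "q > 0" and Qpos: "Q > 0" using pos q Q by auto
  have dvds: "q dvd L" "w dvd L" "w * t dvd L"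
    using Q q by (auto intro: dvd_trans[OF _ Q(2)])
  have q2pos: "q2 > 0" using q2 pos by (metis mult_pos_pos not_le zero_less_numeral gr_zeroI)
  have kcpos: "kc > 0" using kc qpos by (metis mult_0 not_gr_zero)
  have Ldiv: "real (L * (L div u)) = l2 / u" if "u dvd L" for u
    using that by (simp add: l2_def power2_eq_square real_of_nat_div)
  have bx: "\<And>p. p \<in> S \<Longrightarrow> px p < L \<and> py p < L \<and> pz p < L"
    and by': "\<And>p. p \<in> S \<Longrightarrow> py p < L \<and> px p < L \<and> pz p < L"
    and bz: "\<And>p. p \<in> S \<Longrightarrow> pz p < L \<and> px p < L \<and> py p < L"
    and bxy: "\<And>p. p \<in> S \<Longrightarrow> px p < L \<and> py p < L"
    and byx: "\<And>p. p \<in> S \<Longrightarrow> py p < L \<and> px p < L" using bound by auto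
  have inj_yx: "p = r" if "p \<in> S" "r \<in> S" "py p = py r" "px p = px r" for p r
    using inj_xy that by blast

  \<comment> \<open>First pruning: points of \<open>S1\<close> have good columns. The loss
    \<open>\<sigma>\<close> must be very small because it reappears with the factor
    \<open>4096 * D^2\<close> when row gaps are counted.\<close>
  define Gc where "Gc = gaps S S0 px py L w t kc"
  define Ba where "Ba = {p\<in>S. card {a\<in>S. px a = px p \<and> py a div Q = py p div Q \<and> pz a div Q = pz p div Q \<and> py p < py a} < q}"
  define Bb where "Bb = {p\<in>S. card {a\<in>S. px a = px p \<and> py a div Q = py p div Q \<and> pz a div Q = pz p div Q \<and> py a < py p} < q}"
  define Bc where "Bc = {p\<in>S. window_count S px py q (px p) (py p div q) < kc}"
  define Bg where "Bg = {p\<in>S. m < card {j. j div t = py p div q \<and> (px p, j) \<in> Gc}}"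
  define S1 where "S1 = S0 - (Ba \<union> Bb \<union> Bc \<union> Bg)"
  have fins: "finite Ba" "finite Bb" "finite Bc" "finite Bg" "finite Gc" "finite S0" "finite S1"
    unfolding Ba_def Bb_def Bc_def Bg_def Gc_def S1_def using fin S0 finite_gaps
    by (auto intro: finite_subset)
  have piece: "real (k * (2 * L * (L div u))) = real k * 2 * l2 / u" if "u dvd L" for k u
  proof -
    have "real (k * (2 * L * (L div u))) = real k * 2 * real (L * (L div u))" by simp
    then show ?thesis unfolding Ldiv[OF that] by simp
  qed
  have Qr: "real q * 2 * l2 / Q = 2 / R * l2" using Q qpos by (simp add: field_simps)
  have lift: "real a \<le> c" if "a \<le> b" "real b = c" for a b c using that by simp
  have cBa: "real (card Ba) \<le> 2 / R * l2"
    unfolding Ba_def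
    by (rule lift[OF card_few_above_le[OF chx fin Qpos Q(2) bx, of q]]) (assumption | rule trans[OF piece[OF Q(2)] Qr])+
  have cBb: "real (card Bb) \<le> 2 / R * l2"
    unfolding Bb_def
    by (rule lift[OF card_few_below_le[OF chx fin Qpos Q(2) bx, of q]]) (assumption | rule trans[OF piece[OF Q(2)] Qr])+
  have win: "real (k * (L * (L div u))) = real k * l2 / u" if "u dvd L" for k u
  proof -
    have "real (k * (L * (L div u))) = real k * real (L * (L div u))" by simp
    then show ?thesis unfolding Ldiv[OF that] by simp
  qed
  have kcr: "real kc = q / C" using kc pos by (metis nonzero_mult_div_cancel_right of_nat_0_less_iff of_nat_mult less_numeral_extra(3))
  have cr: "real kc * l2 / q = 1 / C * l2" using kcr qpos by simp
  have cBc: "real (card Bc) \<le> 1 / C * l2" unfolding Bc_def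
    by (rule lift[OF card_sparse_window_le[OF fin qpos dvds(1) bxy]]) (assumption | rule trans[OF win[OF dvds(1)] cr])+
  have cBg: "real (card Bg) \<le> (4 * \<eta> * (real C)\<^sup>2 + 2 * \<sigma>0 * C) * (1024 * D) * l2"
  proof -
    have "real kc * C = real w * t" using kc q(1) by (metis of_nat_mult)
    then have tk: "2 * real t / kc = 2 * real C / w" using kcpos pos by (simp add: frac_eq_eq algebra_simps)
    have "real (card Gc) \<le> (energy S px py L w - energy S px py L (w * t)) * w * (2 * real t / kc)\<^sup>2
        + real (card (S - S0)) * (2 * real t / kc)"
      unfolding Gc_def by (rule card_gaps_le[OF fin pos(1) tpos dvds(3) kcpos])
    also have "\<dots> \<le> \<eta> * l2 * w * (2 * real C / w)\<^sup>2 + \<sigma>0 * l2 * (2 * real C / w)"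
      unfolding tk using ex loss q by (intro add_mono mult_right_mono) (auto simp: l2_def)
    also have "\<dots> = (4 * \<eta> * (real C)\<^sup>2 + 2 * \<sigma>0 * C) * l2 / w"
      using pos by (simp add: field_simps power2_eq_square)
    finally have G: "real (card Gc) \<le> (4 * \<eta> * (real C)\<^sup>2 + 2 * \<sigma>0 * C) * l2 / w" .
    have "real m * real (card Bg) \<le> real q * real (card Gc)"
      using of_nat_mono[OF card_many_gaps_le[OF inj_xy fin fins(5) qpos, where m=m and t=t], where 'a=real]
      unfolding Bg_def of_nat_mult .
    also have "\<dots> \<le> real q * ((4 * \<eta> * (real C)\<^sup>2 + 2 * \<sigma>0 * C) * l2 / w)"
      using G by (intro mult_left_mono) auto
    also have "\<dots> = real m * ((4 * \<eta> * (real C)\<^sup>2 + 2 * \<sigma>0 * C) * (1024 * D) * l2)"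
      using q pos by (simp add: field_simps)
    finally show ?thesis using pos by simp
  qed
  have cS1: "real (card (S - S1)) \<le> \<sigma> * l2"
  proof -
    have "S - S1 \<subseteq> (S - S0) \<union> (Ba \<union> (Bb \<union> (Bc \<union> Bg)))" by (auto simp: S1_def)
    then have "card (S - S1) \<le> card ((S - S0) \<union> (Ba \<union> (Bb \<union> (Bc \<union> Bg))))"
      using fins fin by (intro card_mono) auto
    also have "\<dots> \<le> card (S - S0) + (card Ba + (card Bb + (card Bc + card Bg)))"
      by (intro order_trans[OF card_Un_le] add_mono order_refl)
    finally have "real (card (S - S1)) \<le> \<sigma>0 * l2 + (2 / R * l2 + (2 / R * l2 + (1 / C * l2 +
        (4 * \<eta> * (real C)\<^sup>2 + 2 * \<sigma>0 * C) * (1024 * D) * l2)))"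
      using loss cBa cBb cBc cBg unfolding l2_def by linarith
    also have "\<dots> = (\<sigma>0 + 4 / R + 1 / C + (4 * \<eta> * (real C)\<^sup>2 + 2 * \<sigma>0 * C) * (1024 * D)) * l2"
      by (simp add: algebra_simps)
    also have "\<dots> \<le> \<sigma> * l2" using \<sigma> l2 by (intro mult_right_mono) auto
    finally show ?thesis .
  qed

  \<comment> \<open>Second pruning: points of \<open>S2\<close> have good rows and many points of
    \<open>S1\<close> ahead on their level set. Row gaps are taken against \<open>S1\<close>,
    because the point \<open>r\<close> found in the row needs a good column. The density threshold
    \<open>kr\<close> equals \<open>q / (16 * D)\<close>.\<close>
  define kr where "kr = 64 * m * w"
  have krpos: "kr > 0" using pos by (simp add: kr_def)
  define Gr where "Gr = gaps S S1 py px L w t kr"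
  define Bd where "Bd = {p\<in>S. card {a\<in>S. py a = py p \<and> px a div Q = px p div Q \<and> pz a div Q = pz p div Q \<and> px p < px a} < q}"
  define Be where "Be = {p\<in>S1. card {a\<in>S1. pz a = pz p \<and> px a div q = px p div q \<and> py a div q = py p div q \<and> px p < px a} < 32 * m * w}"
  define Bf where "Bf = {p\<in>S. card {a\<in>S. py a = py p \<and> px a div q2 = px p div q2 \<and> px p < px a} < v}"
  define Bh where "Bh = {p\<in>S. window_count S py px q (py p) (px p div q) < kr}"
  define Bi where "Bi = {p\<in>S. 8 * m < card {i. i div t = px p div q \<and> (py p, i) \<in> Gr}}"
  define S2 where "S2 = S1 - (Bd \<union> Be \<union> Bf \<union> Bh \<union> Bi)"
  have S1S: "S1 \<subseteq> S0" "S1 \<subseteq> S" using S0 by (auto simp: S1_def)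
  have fins2: "finite Bd" "finite Be" "finite Bf" "finite Bh" "finite Bi" "finite Gr" "finite S2"
    unfolding Bd_def Be_def Bf_def Bh_def Bi_def Gr_def S2_def using fin fins finite_gaps by auto
  have cBd: "real (card Bd) \<le> 2 / R * l2"
    unfolding Bd_def
    by (rule lift[OF card_few_above_le[OF chy fin Qpos Q(2) by', of q]]) (assumption | rule trans[OF piece[OF Q(2)] Qr])+
  have er: "real (32 * m * w) * 2 * l2 / q = 1 / (16 * D) * l2" using q pos by (simp add: field_simps)
  have bz1: "\<And>p. p \<in> S1 \<Longrightarrow> pz p < L \<and> px p < L \<and> py p < L" using bz S1S by blast
  have cBe: "real (card Be) \<le> 1 / (16 * D) * l2" unfolding Be_def
    by (rule lift[OF card_few_above_le[OF chain_fibres_subset[OF chz S1S(2)] fins(7) qpos dvds(1) bz1]])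
      (assumption | rule trans[OF piece[OF dvds(1)] er])+
  have cBf: "real (card Bf) \<le> 1 / (16 * D) * l2"
  proof -
    have "real (card Bf) \<le> real v * l2 / q2"
      unfolding Bf_def
      by (rule lift[OF card_few_above_window_le[OF inj_yx fin q2pos q2(1) byx]]) (assumption | rule win[OF q2(1)])+
    also have "\<dots> = (real v / q2) * l2" by simp
    also have "\<dots> \<le> 1 / (16 * D) * l2"
    proof -
      have "real (16 * D * v) \<le> real q2" using q2(2) by (rule of_nat_mono)
      then have "real v / q2 \<le> 1 / (16 * D)" using pos q2pos by (simp add: field_simps)
      then show ?thesis using l2 by (intro mult_right_mono) auto
    qed
    finally show ?thesis .
  qed
  have kr: "real kr * l2 / q = 1 / (16 * D) * l2" using q pos by (simp add: kr_def field_simps)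
  have cBh: "real (card Bh) \<le> 1 / (16 * D) * l2" unfolding Bh_def
    by (rule lift[OF card_sparse_window_le[OF fin qpos dvds(1) byx]]) (assumption | rule trans[OF win[OF dvds(1)] kr])+
  have cBi: "real (card Bi) \<le> (131072 * real D ^ 3 * \<eta> + 4096 * (real D)\<^sup>2 * \<sigma>) * l2"
  proof -
    have tk: "2 * real t / kr = 32 * real D / w" using q pos by (simp add: kr_def field_simps)
    have "real (card Gr) \<le> (energy S py px L w - energy S py px L (w * t)) * w * (2 * real t / kr)\<^sup>2
        + real (card (S - S1)) * (2 * real t / kr)"
      unfolding Gr_def by (rule card_gaps_le[OF fin pos(1) tpos dvds(3) krpos])
    also have "\<dots> \<le> \<eta> * l2 * w * (32 * real D / w)\<^sup>2 + \<sigma> * l2 * (32 * real D / w)"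
      unfolding tk using ey cS1 q by (intro add_mono mult_right_mono) (auto simp: l2_def)
    also have "\<dots> = (1024 * (real D)\<^sup>2 * \<eta> + 32 * D * \<sigma>) * l2 / w"
      using pos by (simp add: field_simps power2_eq_square)
    finally have G: "real (card Gr) \<le> (1024 * (real D)\<^sup>2 * \<eta> + 32 * D * \<sigma>) * l2 / w" .
    have "real (8 * m) * real (card Bi) \<le> real q * real (card Gr)"
      using of_nat_mono[OF card_many_gaps_le[OF inj_yx fin fins2(6) qpos, where m="8 * m" and t=t], where 'a=real]
      unfolding Bi_def of_nat_mult .
    also have "\<dots> \<le> real q * ((1024 * (real D)\<^sup>2 * \<eta> + 32 * D * \<sigma>) * l2 / w)"
      using G by (intro mult_left_mono) auto
    also have "\<dots> = real (8 * m) * ((131072 * real D ^ 3 * \<eta> + 4096 * (real D)\<^sup>2 * \<sigma>) * l2)"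
      using q pos by (simp add: field_simps power2_eq_square power3_eq_cube)
    finally show ?thesis using pos by simp
  qed
  have cS2: "l2 \<le> 2 * D * real (card S2)"
  proof -
    have "S \<subseteq> S2 \<union> ((S - S1) \<union> (Bd \<union> (Be \<union> (Bf \<union> (Bh \<union> Bi)))))" by (auto simp: S2_def)
    then have "card S \<le> card (S2 \<union> ((S - S1) \<union> (Bd \<union> (Be \<union> (Bf \<union> (Bh \<union> Bi))))))"
      using fins2 fin by (intro card_mono) auto
    also have "\<dots> \<le> card S2 + (card (S - S1) + (card Bd + (card Be + (card Bf + (card Bh + card Bi)))))"
      by (intro order_trans[OF card_Un_le] add_mono order_refl)
    finally have "real (card S) \<le> card S2 + (\<sigma> * l2 + (2 / R * l2 + (1 / (16 * D) * l2 + (1 / (16 * D) * l2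
        + (1 / (16 * D) * l2 + (131072 * real D ^ 3 * \<eta> + 4096 * (real D)\<^sup>2 * \<sigma>) * l2)))))"
      using cS1 cBd cBe cBf cBh cBi by linarith
    also have "\<dots> = card S2 + (2 / R + \<sigma> + 3 / (16 * D) + 131072 * real D ^ 3 * \<eta> + 4096 * (real D)\<^sup>2 * \<sigma>) * l2"
      by (simp add: algebra_simps add_divide_distrib)
    also have "\<dots> \<le> card S2 + 1 / (2 * D) * l2"
      using small l2 by (intro add_left_mono mult_right_mono) auto
    finally have "D * real (card S) \<le> D * (card S2 + 1 / (2 * D) * l2)"
      by (intro mult_left_mono) auto
    also have "\<dots> = D * card S2 + l2 / 2" using pos by (simp add: field_simps)
    finally show ?thesis using dense unfolding l2_def[symmetric] by simp
  qed

  let ?C = "\<lambda>p. {(i, j). (i, j) \<in> branching S0 w v Q \<and> i div t = px p div q \<and> j div t = py p div q}"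
  have local: "32 * m\<^sup>2 \<le> card (?C p)" if p: "p \<in> S2" for p
  proof (rule branching_cells_near[OF S1S(1) S0 _ pos(1-3) q(1) tpos dvds(2), where Gc=Gc and Gr=Gr and ?q2.0=q2])
    have pS: "p \<in> S" "p \<in> S1" "p \<notin> Bd" "p \<notin> Be" "p \<notin> Bf" "p \<notin> Bh" "p \<notin> Bi"
      using p S1S by (auto simp: S2_def)
    show "p \<in> S" by fact
    show "q \<le> card {a\<in>S. px a = px p \<and> py a div Q = py p div Q \<and> pz a div Q = pz p div Q \<and> py p < py a}"
      if "p \<in> S1" for p using that S1S by (auto simp: S1_def Ba_def not_less)
    show "q \<le> card {a\<in>S. px a = px p \<and> py a div Q = py p div Q \<and> pz a div Q = pz p div Q \<and> py a < py p}"
      if "p \<in> S1" for p using that S1S by (auto simp: S1_def Bb_def not_less)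
    show "\<exists>r\<in>S0. px r = px p \<and> py r div w = j"
      if "p \<in> S1" "j < L div w" "j div t = py p div q" "(px p, j) \<notin> Gc" for p j
    proof -
      have "p \<in> S" "kc \<le> window_count S px py q (px p) (py p div q)"
        using that S1S by (auto simp: S1_def Bc_def)
      then show ?thesis using that bound q unfolding Gc_def gaps_def by auto
    qed
    show "card {j. j div t = py p div q \<and> (px p, j) \<in> Gc} \<le> m" if "p \<in> S1" for p
      using that S1S by (auto simp: S1_def Bg_def not_less)
    show "q \<le> card {a\<in>S. py a = py p \<and> px a div Q = px p div Q \<and> pz a div Q = pz p div Q \<and> px p < px a}"
      using pS by (auto simp: Bd_def)
    show "32 * m * w \<le> card {a\<in>S1. pz a = pz p \<and> px a div q = px p div q \<and> py a div q = py p div q \<and> px p < px a}"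
      using pS by (auto simp: Be_def)
    have "v \<le> card {a\<in>S. py a = py p \<and> px a div q2 = px p div q2 \<and> px p < px a}"
      using pS by (auto simp: Bf_def)
    also have "\<dots> \<le> card {a\<in>S. py a = py p \<and> px p < px a \<and> px a < px p + q2}"
      using fin same_block_less[OF _ q2pos] by (intro card_mono) auto
    finally show "v \<le> card {a\<in>S. py a = py p \<and> px p < px a \<and> px a < px p + q2}" .
    show "\<exists>r\<in>S1. py r = py p \<and> px r div w = i"
      if "i < L div w" "i div t = px p div q" "(py p, i) \<notin> Gr" for i
    proof -
      have "kr \<le> window_count S py px q (py p) (px p div q)"
        using pS by (auto simp: Bh_def)
      then show ?thesis using that bound[OF pS(1)] q unfolding Gr_def gaps_def by auto
    qed
    show "card {i. i div t = px p div q \<and> (py p, i) \<in> Gr} \<le> 8 * m"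
      using pS by (auto simp: Bi_def)
  qed (use fins fins2 q2 in auto)

  let ?Br = "branching S0 w v Q"
  have finBr: "finite ?Br" by (rule finite_branching[OF S0])
  \<comment> \<open>Double count the pairs of a typical point and a branching window in its block of
    side \<open>q\<close>.\<close>
  have "card S2 * (32 * m\<^sup>2) = (\<Sum>p\<in>S2. 32 * m\<^sup>2)" by simp
  also have "\<dots> \<le> (\<Sum>p\<in>S2. card (?C p))" by (intro sum_mono local)
  also have "\<dots> = card (Sigma S2 ?C)"
    using finBr fins2 by (subst card_SigmaI) (auto intro: finite_subset[OF _ finBr])
  also have "\<dots> \<le> card (Sigma ?Br (\<lambda>(i, j). {p\<in>S. px p div q = i div t \<and> py p div q = j div t}))"
  proof (rule card_inj_on_le[of prod.swap])
    show "finite (Sigma ?Br (\<lambda>(i, j). {p\<in>S. px p div q = i div t \<and> py p div q = j div t}))"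
      using fin finBr by (intro finite_SigmaI) auto
    show "prod.swap ` Sigma S2 ?C \<subseteq> Sigma ?Br (\<lambda>(i, j). {p\<in>S. px p div q = i div t \<and> py p div q = j div t})"
      using S1S by (auto simp: S2_def)
  qed simp
  also have "\<dots> = (\<Sum>e\<in>?Br. card {p\<in>S. px p div q = fst e div t \<and> py p div q = snd e div t})"
    using fin finBr by (subst card_SigmaI) (auto simp: case_prod_beta)
  also have "\<dots> \<le> (\<Sum>e\<in>?Br. q\<^sup>2)" by (intro sum_mono card_block_le qpos)
  finally have "card S2 * (32 * m\<^sup>2) \<le> card ?Br * q\<^sup>2" by simp
  then have "real (card S2 * (32 * m\<^sup>2)) \<le> real (card ?Br * q\<^sup>2)" by (rule of_nat_mono)
  then have "real (card S2) * 32 * (real m)\<^sup>2 \<le> card ?Br * (real w * 1024 * D * m)\<^sup>2"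
    using q by (simp add: mult.assoc)
  also have "\<dots> = (card ?Br * 32768 * (real w)\<^sup>2 * (real D)\<^sup>2) * 32 * (real m)\<^sup>2"
    by (simp add: power_mult_distrib)
  \<comment> \<open>The factor \<open>m^2\<close> cancels, so the proportion of branching windows is
    the same at every scale.\<close>
  finally have "real (card S2) \<le> card ?Br * 32768 * (real w)\<^sup>2 * (real D)\<^sup>2"
    using pos by (simp add: mult_ac)
  then have "2 * D * real (card S2) \<le> 2 * D * (card ?Br * 32768 * (real w)\<^sup>2 * (real D)\<^sup>2)"
    by (intro mult_left_mono) auto
  also have "\<dots> = 65536 * real D ^ 3 * (real w)\<^sup>2 * card ?Br"
    by (simp add: power2_eq_square power3_eq_cube)
  finally show ?thesis using cS2 unfolding l2_def by linarith
qed simp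

end

text \<open>These are terms of the hypotheses \<open>\<sigma>\<close> and \<open>small\<close> of
  \<open>branching_cells_lower_bound\<close> for \<open>d = D\<close>,
  \<open>\<eta> = 2 / A\<close>, \<open>\<sigma>0 = 4 / lam\<close>,
  \<open>C = 2 ^ 19 * D ^ 3\<close> and \<open>\<sigma> = 1 / (65536 * D ^ 3)\<close>.\<close>

lemma parameter_identities:
  fixes d :: real
  assumes "d > 0"
  shows "4 * (2 / (2 ^ 70 * d ^ 10)) * (2 ^ 19 * d ^ 3)\<^sup>2 * (1024 * d) = 1 / (524288 * d ^ 3)"
    "2 * (4 / (2 ^ 51 * d ^ 7)) * (2 ^ 19 * d ^ 3) * (1024 * d) = 1 / (524288 * d ^ 3)"
    "131072 * d ^ 3 * (2 / (2 ^ 70 * d ^ 10)) = 1 / (2 ^ 52 * d ^ 7)"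
    "4096 * d\<^sup>2 * (1 / (65536 * d ^ 3)) = 1 / (16 * d)"
proof -
  define x where "x = d ^ 3"
  have p: "d ^ 10 = x * x * x * d" "d ^ 7 = x * x * d" "d\<^sup>2 = x / d" "d ^ 3 = x"
    using assms by (simp_all add: x_def field_simps flip: power_add power_Suc2 power_Suc)
  have "x > 0" using assms by (simp add: x_def)
  then show "4 * (2 / (2 ^ 70 * d ^ 10)) * (2 ^ 19 * d ^ 3)\<^sup>2 * (1024 * d) = 1 / (524288 * d ^ 3)"
    "2 * (4 / (2 ^ 51 * d ^ 7)) * (2 ^ 19 * d ^ 3) * (1024 * d) = 1 / (524288 * d ^ 3)"
    "131072 * d ^ 3 * (2 / (2 ^ 70 * d ^ 10)) = 1 / (2 ^ 52 * d ^ 7)"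
    "4096 * d\<^sup>2 * (1 / (65536 * d ^ 3)) = 1 / (16 * d)"
    unfolding p using assms by (simp_all add: power_mult_distrib power2_eq_square)
qed

lemma pigeonhole_decrement:
  fixes F :: "nat \<Rightarrow> real"
  assumes "n > 0" "F 0 \<le> M" "0 \<le> F n"
  obtains a where "a < n" "F a - F (Suc a) \<le> M / n"
proof (rule ccontr)
  assume *: "\<not> thesis"
  then have lt: "M / n < F a - F (Suc a)" if "a < n" for a
    using that assms(1) \<open>\<And>a. \<lbrakk>a < n; F a - F (Suc a) \<le> M / real n\<rbrakk> \<Longrightarrow> thesis\<close> by force
  have "(\<Sum>a<n. M / n) < (\<Sum>a<n. F a - F (Suc a))"
    using assms lt by (intro sum_strict_mono) auto
  also have "\<dots> = F 0 - F n" by (rule sum_lessThan_telescope')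
  finally show False using assms by simp
qed

section \<open>Heavy cells and the contradiction between scales\<close>

context chain_system
begin

lemma chain_system_mono:
  assumes "L \<le> L'"
  shows "chain_system S px py pz L'"
  using fin bound chx chy chz assms unfolding chain_system_def by (meson less_le_trans)

lemma card_le: "card S \<le> L\<^sup>2"
proof (cases "L = 0")
  case True
  then have "S = {}" using bound by auto
  then show ?thesis by simp
next
  case False
  have "S = {p\<in>S. px p div L = 0 \<and> py p div L = 0}" using bound by auto
  then show ?thesis using card_block_le[of L 0 0] False by simp
qed

definition cell :: "nat \<Rightarrow> 'a \<Rightarrow> nat \<times> nat \<times> nat" where
  "cell w p = (px p div w, py p div w, pz p div w)"

text \<open>Prune twice: first the points with a light column piece, then the points whose row piece
  has become light. In the cell of a surviving point, \<open>k\<close> points of its row each carry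
  a column piece of \<open>k\<close> points, and these pieces are disjoint.\<close>

lemma heavy_subset:
  assumes w: "w > 0" "w dvd L"
  obtains S0 where "S0 \<subseteq> S" "card (S - S0) \<le> 2 * (k * (2 * L * (L div w)))"
    "k\<^sup>2 * card (cell w ` S0) \<le> card S"
proof -
  let ?kx = "\<lambda>p. (px p, py p div w, pz p div w)"
  let ?ky = "\<lambda>p. (py p, px p div w, pz p div w)"
  define S' where "S' = {p\<in>S. k \<le> card {a\<in>S. ?kx a = ?kx p}}"
  define S0 where "S0 = {p\<in>S'. k \<le> card {a\<in>S'. ?ky a = ?ky p}}"
  have sub: "S0 \<subseteq> S'" "S' \<subseteq> S" by (auto simp: S0_def S'_def)
  have fin': "finite S'" "finite S0" using fin sub by (auto intro: finite_subset)
  have b1: "\<And>p. p \<in> S \<Longrightarrow> px p < L \<and> py p < L \<and> pz p < L"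
    and b2: "\<And>p. p \<in> S' \<Longrightarrow> py p < L \<and> px p < L \<and> pz p < L" using bound sub by auto
  have "card (S - S') \<le> k * card (?kx ` S)"
    using card_light_le[OF fin, of ?kx k] by (simp add: S'_def set_diff_eq not_le conj_commute cong: conj_cong)
  also have "\<dots> \<le> k * (2 * L * (L div w))"
    by (intro mult_le_mono2 card_pieces_le[OF chx w b1])
  finally have 1: "card (S - S') \<le> k * (2 * L * (L div w))" .
  have "card (S' - S0) \<le> k * card (?ky ` S')"
    using card_light_le[OF fin'(1), of ?ky k] by (simp add: S0_def set_diff_eq not_le conj_commute cong: conj_cong)
  also have "\<dots> \<le> k * (2 * L * (L div w))"
    by (intro mult_le_mono2 card_pieces_le[OF chain_fibres_subset[OF chy sub(2)] w b2])
  finally have 2: "card (S' - S0) \<le> k * (2 * L * (L div w))" .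
  have "S - S0 \<subseteq> (S - S') \<union> (S' - S0)" by auto
  then have "card (S - S0) \<le> card ((S - S') \<union> (S' - S0))" using fin fin' by (intro card_mono) auto
  also have "\<dots> \<le> card (S - S') + card (S' - S0)" by (rule card_Un_le)
  finally have loss: "card (S - S0) \<le> 2 * (k * (2 * L * (L div w)))" using 1 2 by linarith
  have heavy: "k\<^sup>2 \<le> card {b\<in>S. cell w b = cell w p}" if p: "p \<in> S0" for p
  proof -
    define A where "A = {a\<in>S'. ?ky a = ?ky p}"
    have A: "finite A" "k \<le> card A" using p fin' by (auto simp: A_def S0_def)
    have dis: "{b\<in>S. ?kx b = ?kx a} \<inter> {b\<in>S. ?kx b = ?kx a'} = {}"
      if "a \<in> A" "a' \<in> A" "a \<noteq> a'" for a a'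
    proof -
      have "a \<in> S" "a' \<in> S" "py a = py a'" using that sub by (auto simp: A_def)
      then have "px a \<noteq> px a'" using chain_fibresD(2)[OF chy, of a a'] that(3) by auto
      then show ?thesis by auto
    qed
    have "k\<^sup>2 \<le> (\<Sum>a\<in>A. k)" using A by (simp add: power2_eq_square)
    also have "\<dots> \<le> (\<Sum>a\<in>A. card {b\<in>S. ?kx b = ?kx a})"
      by (rule sum_mono) (auto simp: A_def S'_def)
    also have "\<dots> = card (\<Union>a\<in>A. {b\<in>S. ?kx b = ?kx a})"
      using A fin dis by (subst card_UN_disjoint) auto
    also have "\<dots> \<le> card {b\<in>S. cell w b = cell w p}"
      using fin by (intro card_mono) (auto simp: A_def cell_def)
    finally show ?thesis .
  qed
  have "k\<^sup>2 * card (cell w ` S0) = (\<Sum>c\<in>cell w ` S0. k\<^sup>2)" by simp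
  also have "\<dots> \<le> (\<Sum>c\<in>cell w ` S0. card {b\<in>S. cell w b = c})"
    using heavy by (intro sum_mono) auto
  also have "\<dots> = card (\<Union>c\<in>cell w ` S0. {b\<in>S. cell w b = c})"
    using fin fin' by (subst card_UN_disjoint) auto
  also have "\<dots> \<le> card S" using fin by (intro card_mono) auto
  finally show ?thesis using that[of S0] sub loss by blast
qed

text \<open>Over a fixed window, passing from blocks of size \<open>u b\<close> to
  \<open>u (Suc b)\<close> merges occupied height blocks, and strictly reduces their number if the
  window branches. Telescoping bounds the number of branching scales by the number of occupied cells
  at scale \<open>w\<close>.\<close>

lemma sum_card_branching_le:
  assumes T: "T \<subseteq> S" and u: "u 0 = w" "\<And>b. u b dvd u (Suc b)"
  shows "(\<Sum>b<B. card (branching T w (u b) (u (Suc b)))) \<le> card (cell w ` T)"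
proof -
  define E where "E = (\<lambda>p. (px p div w, py p div w)) ` T"
  define Z where "Z = (\<lambda>b e. (\<lambda>p. pz p div u b) ` {p\<in>T. (px p div w, py p div w) = e})"
  let ?Br = "\<lambda>b. branching T w (u b) (u (Suc b))"
  have finT: "finite T" "finite E" using T fin by (auto simp: E_def intro: finite_subset)
  have finZ: "finite (Z b e)" for b e using finT by (simp add: Z_def)
  have step: "(if e \<in> ?Br b then 1 else 0) + card (Z (Suc b) e) \<le> card (Z b e)" for b e
  proof -
    obtain r where r: "u (Suc b) = u b * r" using u(2)[of b] by auto
    have Z: "Z (Suc b) e = (\<lambda>z. z div r) ` Z b e"
      unfolding Z_def image_image r div_mult2_eq ..
    show ?thesis
    proof (cases "e \<in> ?Br b")
      case True
      then obtain p s where ps: "p \<in> T" "s \<in> T" "(px p div w, py p div w) = e" "(px s div w, py s div w) = e"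
        "pz p div u (Suc b) = pz s div u (Suc b)" "pz p div u b \<noteq> pz s div u b"
        by (auto simp: branching_def)
      have "pz p div u b \<in> Z b e" "pz s div u b \<in> Z b e"
        unfolding Z_def using ps by blast+
      moreover have "pz p div u b div r = pz s div u b div r" using ps(5) by (simp add: r div_mult2_eq)
      ultimately have "\<not> inj_on (\<lambda>z. z div r) (Z b e)" using ps(6) by (auto dest: inj_onD)
      then have "card (Z (Suc b) e) \<noteq> card (Z b e)"
        using finZ by (simp add: Z inj_on_iff_eq_card)
      then show ?thesis using card_image_le[OF finZ, of "\<lambda>z. z div r" b e] by (simp add: Z)
    next
      case False
      then show ?thesis using card_image_le[OF finZ, of "\<lambda>z. z div r" b e] by (simp add: Z)
    qed
  qed
  have tele: "(\<Sum>b<n. if e \<in> ?Br b then 1 else 0) + card (Z n e) \<le> card (Z 0 e)" for e n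
  proof (induction n)
    case (Suc n)
    then show ?case using step[where e=e and b=n] by simp
  qed simp
  have "(\<Sum>b<B. card (?Br b)) = (\<Sum>b<B. \<Sum>e\<in>E. if e \<in> ?Br b then 1 else 0)"
  proof (rule sum.cong)
    fix b
    have "?Br b \<subseteq> E" by (auto simp: branching_def E_def)
    then have "E \<inter> {e. e \<in> ?Br b} = ?Br b" by auto
    then show "card (?Br b) = (\<Sum>e\<in>E. if e \<in> ?Br b then 1 else 0)"
      using finT by (simp add: sum.If_cases)
  qed simp
  also have "\<dots> = (\<Sum>e\<in>E. \<Sum>b<B. if e \<in> ?Br b then 1 else 0)" by (rule sum.swap)
  also have "\<dots> \<le> (\<Sum>e\<in>E. card (Z 0 e))"
  proof (rule sum_mono)
    fix e show "(\<Sum>b<B. if e \<in> ?Br b then 1 else 0) \<le> card (Z 0 e)"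
      using tele[where e=e and n=B] by linarith
  qed
  also have "\<dots> = card (Sigma E (Z 0))" using finT finZ by simp
  also have "\<dots> \<le> card (cell w ` T)"
  proof (rule card_inj_on_le[of "\<lambda>((i, j), k). (i, j, k)"])
    show "inj_on (\<lambda>((i, j), k). (i, j, k)) (Sigma E (Z 0))" by (auto simp: inj_on_def)
    show "(\<lambda>((i, j), k). (i, j, k)) ` Sigma E (Z 0) \<subseteq> cell w ` T"
      by (auto simp: Z_def u(1) cell_def)
  qed (use finT in simp)
  finally show ?thesis .
qed

text \<open>\<open>B\<close> exceeds the number of branching scales that the cell count allows, \<open>A\<close> makes the
  energy increment \<open>2 / A\<close> small, and \<open>lam\<close> is the ratio of consecutive scales.\<close>

lemma not_dense:
  fixes D lam A B :: nat
  assumes D: "D > 0" and lam: "lam = 2 ^ 51 * D ^ 7" and A: "A = 2 ^ 70 * D ^ 10"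
    and B: "B = 2 ^ 16 * D ^ 3 * lam\<^sup>2 + 1"
    and L: "lam ^ (1 + 3 * B * A) dvd L" "L > 0"
  shows "D * card S < L\<^sup>2"
proof (rule ccontr)
  assume "\<not> ?thesis"
  then have "real (L\<^sup>2) \<le> real (D * card S)" by (intro of_nat_mono) simp
  then have dense: "(real L)\<^sup>2 \<le> D * real (card S)" by simp
  have lampos: "lam > 0" and Apos: "A > 0" and Bpos: "B > 0" using D lam A B by auto
  let ?M = "1 + 3 * B * A"
  have dvdL: "lam ^ e dvd L" if "e \<le> ?M" for e
    using that by (meson L(1) dvd_trans le_imp_power_dvd)
  have inj_yx: "p = r" if "p \<in> S" "r \<in> S" "py p = py r" "px p = px r" for p r
    using inj_xy that by blast
  \<comment> \<open>Pigeonhole over \<open>A\<close> groups of \<open>3 * B\<close> consecutive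
    scales. The \<open>1 +\<close> in the exponent makes the smallest scale \<open>w\<close>
    divisible by \<open>lam\<close>.\<close>
  define F where "F a = energy S px py L (lam ^ (1 + 3 * B * a)) + energy S py px L (lam ^ (1 + 3 * B * a))" for a
  have "F 0 \<le> 2 * (real L)\<^sup>2"
  proof -
    have "lam dvd L" using dvdL[of 1] by simp
    then have "energy S px py L lam \<le> (real L)\<^sup>2" "energy S py px L lam \<le> (real L)\<^sup>2"
      by (auto intro!: energy_le lampos inj_xy)
    then show ?thesis by (simp add: F_def)
  qed
  moreover have "0 \<le> F A" by (simp add: F_def energy_nonneg)
  ultimately obtain a where a: "a < A" "F a - F (Suc a) \<le> 2 * (real L)\<^sup>2 / A"
    using pigeonhole_decrement[OF Apos] by blast
  define w where "w = lam ^ (1 + 3 * B * a)"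
  have e_le: "1 + 3 * B * a + 3 * B \<le> ?M"
  proof -
    have "3 * B * a + 3 * B = 3 * B * Suc a" by simp
    also have "\<dots> \<le> 3 * B * A" using a by (intro mult_le_mono2) simp
    finally show ?thesis by simp
  qed
  have wpos: "w > 0" using lampos by (simp add: w_def)
  have dvdw: "w * lam ^ e dvd L" if "e \<le> 3 * B" for e
    using dvdL[of "1 + 3 * B * a + e"] that e_le by (simp add: w_def power_add mult.assoc)
  have mono: "energy S f g L (w * lam ^ (3 * B)) \<le> energy S f g L (w * lam ^ e)" if "e \<le> 3 * B" for f g e
  proof -
    have "energy S f g L (w * lam ^ e * lam ^ (3 * B - e)) \<le> energy S f g L (w * lam ^ e)"
      using wpos lampos that dvdw[of "3 * B"]
      by (intro energy_antimono[OF fin]) (auto simp: mult.assoc power_add[symmetric])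
    then show ?thesis using that by (simp add: mult.assoc power_add[symmetric])
  qed
  have Fa: "F a - F (Suc a) = (energy S px py L w - energy S px py L (w * lam ^ (3 * B)))
     + (energy S py px L w - energy S py px L (w * lam ^ (3 * B)))"
    by (simp add: F_def w_def power_add algebra_simps)
  define \<eta> where "\<eta> = 2 / real A"
  have en: "energy S px py L w - energy S px py L (w * lam ^ e) \<le> \<eta> * (real L)\<^sup>2"
    "energy S py px L w - energy S py px L (w * lam ^ e) \<le> \<eta> * (real L)\<^sup>2" if "e \<le> 3 * B" for e
    using a(2) Fa mono[OF that, of px py] mono[OF that, of py px]
      mono[of 0 px py] mono[of 0 py px] by (auto simp: \<eta>_def)
  have wlam: "lam dvd w" by (simp add: w_def)
  \<comment> \<open>A fixed fraction of \<open>w\<close>: cells are then heavy up to the factor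
    \<open>lam^2\<close>, while the loss is only the fraction \<open>4 / lam\<close> of
    \<open>L^2\<close>.\<close>
  define k where "k = w div lam"
  have k: "k * lam = w" using wlam by (simp add: k_def)
  have wL: "w dvd L" using dvdw[of 0] by simp
  obtain S0 where S0: "S0 \<subseteq> S" "card (S - S0) \<le> 2 * (k * (2 * L * (L div w)))"
    "k\<^sup>2 * card (cell w ` S0) \<le> card S" using heavy_subset[OF wpos wL] .
  define \<sigma>0 where "\<sigma>0 = 4 / real lam"
  have loss: "real (card (S - S0)) \<le> \<sigma>0 * (real L)\<^sup>2"
  proof -
    have "real (card (S - S0)) \<le> real (2 * (k * (2 * L * (L div w))))" using S0(2) by (rule of_nat_mono)
    also have "\<dots> = 4 * real k * L * (L / w)" using wL by (simp add: real_of_nat_div)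
    also have "\<dots> = \<sigma>0 * (real L)\<^sup>2"
      using k lampos wpos by (simp add: \<sigma>0_def power2_eq_square field_simps flip: k)
    finally show ?thesis .
  qed
  define C where "C = 2 ^ 19 * D ^ 3"
  define \<sigma> where "\<sigma> = 1 / (65536 * real D ^ 3)"
  have Dr: "real D \<ge> 1" using D by simp
  define d where "d = real D"
  have d: "d > 0" using D by (simp add: d_def)
  \<comment> \<open>In units of \<open>1 / (524288 * d ^ 3)\<close>, the budget
    \<open>\<sigma>\<close> is 8 and each of the five terms is at most 1.\<close>
  have \<sigma>: "\<sigma>0 + 4 / lam + 1 / C + (4 * \<eta> * (real C)\<^sup>2 + 2 * \<sigma>0 * C) * (1024 * D) \<le> \<sigma>"
  proof -
    have s0: "\<sigma>0 \<le> 1 / (524288 * d ^ 3)"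
    proof -
      have "d ^ 3 \<le> d ^ 7" using Dr by (intro power_increasing) (auto simp: d_def)
      then have "524288 * d ^ 3 \<le> 2 ^ 49 * d ^ 7" using d by (intro mult_mono) auto
      moreover have "\<sigma>0 = 1 / (2 ^ 49 * d ^ 7)" using d by (simp add: \<sigma>0_def lam d_def)
      ultimately show ?thesis using d by (simp add: frac_le)
    qed
    have "1 / real C = 1 / (524288 * d ^ 3)" by (simp add: C_def d_def)
    moreover have "4 * \<eta> * (real C)\<^sup>2 * (1024 * D) = 1 / (524288 * d ^ 3)"
      using parameter_identities(1)[OF d] by (simp add: \<eta>_def A C_def d_def)
    moreover have "2 * \<sigma>0 * C * (1024 * D) = 1 / (524288 * d ^ 3)"
      using parameter_identities(2)[OF d] by (simp add: \<sigma>0_def lam C_def d_def)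
    moreover have "\<sigma> = 8 * (1 / (524288 * d ^ 3))" by (simp add: \<sigma>_def d_def)
    moreover have "4 / real lam = \<sigma>0" by (simp add: \<sigma>0_def)
    moreover have "0 < 1 / (524288 * d ^ 3)" using d by simp
    ultimately show ?thesis using s0 unfolding distrib_right by linarith
  qed
  \<comment> \<open>In units of \<open>1 / (16 * d)\<close>, the right side is 8 and the left side
    is at most \<open>1 + 1 + 3 + 1 + 1\<close>.\<close>
  have small: "2 / lam + \<sigma> + 3 / (16 * D) + 131072 * real D ^ 3 * \<eta> + 4096 * (real D)\<^sup>2 * \<sigma> \<le> 1 / (2 * D)"
  proof -
    have pow: "d \<le> d ^ n" if "n > 0" for n using Dr that by (simp add: d_def self_le_power)
    have "1 / (c * d ^ n) \<le> 1 / (16 * d)" if "c \<ge> 16" "n > 0" for c n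
      using pow[OF that(2)] that d by (intro divide_left_mono mult_mono) auto
    from this[of "2 ^ 50" 7] this[of 65536 3] this[of "2 ^ 52" 7]
    have "1 / (2 ^ 50 * d ^ 7) \<le> 1 / (16 * d)" "1 / (65536 * d ^ 3) \<le> 1 / (16 * d)"
      "1 / (2 ^ 52 * d ^ 7) \<le> 1 / (16 * d)" by simp_all
    moreover have "2 / real lam = 1 / (2 ^ 50 * d ^ 7)" by (simp add: lam d_def)
    moreover have "131072 * real D ^ 3 * \<eta> = 1 / (2 ^ 52 * d ^ 7)"
      using parameter_identities(3)[OF d] by (simp add: \<eta>_def A d_def)
    moreover have "4096 * (real D)\<^sup>2 * \<sigma> = 1 / (16 * d)"
      using parameter_identities(4)[OF d] by (simp add: \<sigma>_def d_def)
    moreover have "1 / (2 * real D) = 8 * (1 / (16 * d))" "3 / (16 * real D) = 3 * (1 / (16 * d))"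
      by (simp_all add: d_def)
    moreover have "\<sigma> = 1 / (65536 * d ^ 3)" by (simp add: \<sigma>_def d_def)
    moreover have "0 < 1 / (16 * d)" using d by simp
    ultimately show ?thesis by (simp only: of_nat_mult of_nat_numeral)
  qed
  \<comment> \<open>Three factors \<open>lam\<close> per step, because with \<open>v = u b\<close>
    the step uses \<open>q2 = v * lam\<close>, \<open>q = v * lam^2\<close> and
    \<open>Q = v * lam^3 = u (Suc b)\<close>.\<close>
  define u where "u b = w * lam ^ (3 * b)" for b
  have br: "(real L)\<^sup>2 \<le> 65536 * real D ^ 3 * (real w)\<^sup>2 * card (branching S0 w (u b) (u (Suc b)))"
    if b: "b < B" for b
  proof -
    define v where "v = u b"
    \<comment> \<open>The numbers \<open>m\<close> and \<open>kc\<close> come from splitting one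
      factor \<open>lam = 2 ^ 51 * D ^ 7\<close> as \<open>1024 * D * (2 ^ 41 * D ^ 6)\<close> and
      as \<open>(2 ^ 32 * D ^ 4) * C\<close>.\<close>
    define m where "m = lam ^ (3 * b + 1) * (2 ^ 41 * D ^ 6)"
    define q where "q = w * lam ^ (3 * b + 2)"
    define kc where "kc = lam * v * (2 ^ 32 * D ^ 4)"
    have vpos: "v > 0" using wpos lampos by (simp add: v_def u_def)
    have mpos: "m > 0" using lampos D by (simp add: m_def)
    have tt: "lam ^ (3 * b + 2) = 1024 * D * m"
    proof -
      have "lam ^ (3 * b + 2) = lam ^ (3 * b + 1) * lam" by simp
      also have "\<dots> = lam ^ (3 * b + 1) * (1024 * D * (2 ^ 41 * D ^ 6))"
        by (subst (2) lam) (simp add: power_add[symmetric] flip: power_Suc)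
      finally show ?thesis by (simp add: m_def)
    qed
    have Q: "u (Suc b) = q * lam" "u (Suc b) dvd L"
      using dvdw[of "3 * Suc b"] b by (simp_all add: u_def q_def eval_nat_numeral mult_ac)
    have q2: "w * lam ^ (3 * b + 1) dvd L" using b by (intro dvdw) simp
    have q2': "16 * D * v \<le> w * lam ^ (3 * b + 1)"
    proof -
      have "D \<le> D ^ 7" using D by (simp add: self_le_power)
      then have "16 * D \<le> lam" unfolding lam by simp
      then have "16 * D * v \<le> lam * v" by (rule mult_le_mono1)
      then show ?thesis by (simp add: v_def u_def mult_ac)
    qed
    have q2'': "w * lam ^ (3 * b + 1) + w \<le> 8 * m * w"
    proof -
      have "lam ^ (3 * b + 1) * 1 \<le> m" unfolding m_def using D by (intro mult_le_mono2) simp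
      then have "lam ^ (3 * b + 1) + 1 \<le> 8 * m" using mpos by linarith
      then have "(lam ^ (3 * b + 1) + 1) * w \<le> 8 * m * w" by (rule mult_le_mono1)
      then show ?thesis by (simp add: algebra_simps)
    qed
    have kc: "kc * C = q"
    proof -
      have "kc * C = lam * v * (2 ^ 51 * D ^ 7)"
        by (simp add: kc_def C_def power_add[symmetric] mult_ac flip: power_add)
      also have "\<dots> = q" unfolding lam[symmetric] by (simp add: q_def v_def u_def mult_ac)
      finally show ?thesis .
    qed
    have e: "3 * b + 2 \<le> 3 * B" using b by simp
    show ?thesis
      unfolding v_def[symmetric]
      by (rule branching_cells_lower_bound[OF S0(1) dense wpos vpos mpos D lampos _ q_def tt Q q2 q2' q2'' kc
            en(1)[OF e, folded q_def] en(2)[OF e, folded q_def] loss \<sigma> small])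
         (simp add: C_def D)
  qed
  \<comment> \<open>There are at most \<open>L^2 / k^2\<close> heavy cells and
    \<open>w = k * lam\<close>, so the total is at most \<open>2 ^ 16 * D ^ 3 * lam^2 * L^2\<close>,
    which the \<open>+ 1\<close> in \<open>B\<close> exceeds.\<close>
  have "B * (real L)\<^sup>2 = (\<Sum>b<B. (real L)\<^sup>2)" by simp
  also have "\<dots> \<le> (\<Sum>b<B. 65536 * real D ^ 3 * (real w)\<^sup>2 * card (branching S0 w (u b) (u (Suc b))))"
    by (intro sum_mono br) simp
  also have "\<dots> = 65536 * real D ^ 3 * (real w)\<^sup>2 * real (\<Sum>b<B. card (branching S0 w (u b) (u (Suc b))))"
    by (simp add: sum_distrib_left)
  also have "\<dots> \<le> 65536 * real D ^ 3 * (real w)\<^sup>2 * real (card (cell w ` S0))"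
    by (intro mult_left_mono of_nat_mono sum_card_branching_le[OF S0(1)])
      (auto simp: u_def intro!: le_imp_power_dvd)
  also have "\<dots> = 65536 * real D ^ 3 * (real lam)\<^sup>2 * real (k\<^sup>2 * card (cell w ` S0))"
    by (simp add: power_mult_distrib mult_ac flip: k)
  also have "\<dots> \<le> 65536 * real D ^ 3 * (real lam)\<^sup>2 * real (L\<^sup>2)"
    using S0(3) card_le by (intro mult_left_mono of_nat_mono) (auto intro: order_trans)
  also have "\<dots> < real B * (real L)\<^sup>2" using L(2) by (simp add: B algebra_simps)
  finally show False by simp
qed

end

text \<open>Every parameter is bounded by a power of \<open>x = 2 * D\<close>, using
  \<open>2 ^ m * D ^ n \<le> x ^ m\<close> for \<open>n \<le> m\<close>; leftover numerical factors
  are absorbed into further powers of \<open>x\<close>.\<close>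

lemma scale_bound:
  fixes D lam A B x :: nat
  assumes D: "D > 0" and lam: "lam = 2 ^ 51 * D ^ 7" and A: "A = 2 ^ 70 * D ^ 10"
    and B: "B = 2 ^ 16 * D ^ 3 * lam\<^sup>2 + 1" and x: "x = 2 * D"
  shows "lam ^ (1 + 3 * B * A) \<le> 2 ^ (x ^ 198)"
proof -
  have x2: "x \<ge> 2" using D x by simp
  have pow: "2 ^ m * D ^ n \<le> x ^ m" if "n \<le> m" for m n
    unfolding x power_mult_distrib using D that by (intro mult_le_mono2 power_increasing) auto
  have l: "lam \<le> x ^ 51" unfolding lam by (rule pow) simp
  have a: "A \<le> x ^ 70" unfolding A by (rule pow) simp
  have "B \<le> x ^ 16 * (x ^ 51)\<^sup>2 + 1"
    unfolding B using l by (intro add_mono mult_le_mono pow power_mono) auto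
  also have "\<dots> = x ^ 118 + 1" by (simp flip: power_mult power_add)
  also have "\<dots> \<le> 2 * x ^ 118" using x2 by simp
  also have "\<dots> \<le> x * x ^ 118" using x2 by (rule mult_le_mono1)
  finally have b: "B \<le> x ^ 119" by (simp flip: power_Suc)
  have "3 * B * A \<le> 3 * x ^ 119 * x ^ 70" using a b by (intro mult_le_mono) auto
  then have "1 + 3 * B * A \<le> 1 + 3 * x ^ 189" by (simp add: mult.assoc flip: power_add)
  also have "\<dots> \<le> 2 ^ 2 * x ^ 189" using x2 by simp
  also have "\<dots> \<le> x ^ 2 * x ^ 189" using x2 by (intro mult_le_mono1 power_mono) auto
  finally have M: "1 + 3 * B * A \<le> x ^ 191" by (simp flip: power_add)
  have "x \<ge> 1" using x2 by simp
  have "lam ^ (1 + 3 * B * A) \<le> (x ^ 51) ^ (1 + 3 * B * A)" using l by (rule power_mono) simp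
  also have "\<dots> \<le> (x ^ 51) ^ (x ^ 191)" using M \<open>x \<ge> 1\<close> by (intro power_increasing) auto
  also have "\<dots> = x ^ (51 * x ^ 191)" by (simp add: power_mult)
  also have "\<dots> \<le> (2 ^ x) ^ (51 * x ^ 191)" by (intro power_mono) (auto intro: less_imp_le)
  also have "\<dots> = 2 ^ (51 * x ^ 192)" by (simp add: mult_ac flip: power_mult power_Suc)
  also have "\<dots> \<le> 2 ^ (x ^ 198)"
  proof (rule power_increasing)
    have "51 * x ^ 192 \<le> 2 ^ 6 * x ^ 192" by simp
    also have "\<dots> \<le> x ^ 6 * x ^ 192" using x2 by (intro mult_le_mono1 power_mono) auto
    finally show "51 * x ^ 192 \<le> x ^ 198" by (simp flip: power_add)
  qed simp
  finally show ?thesis .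
qed

text \<open>The divisibility condition is removed by rounding \<open>L\<close> up to a multiple
  \<open>L'\<close> of \<open>P\<close>, which is at most \<open>2 * L\<close>. Using
  \<open>4 * D\<close> in place of \<open>D\<close> pays for the factor 4 in
  \<open>(2 * L)^2\<close>.\<close>

lemma (in chain_system) sparse:
  assumes D: "D > 0" and L: "2 ^ ((8 * D) ^ 198) \<le> L"
  shows "D * card S < L\<^sup>2"
proof -
  define lam where "lam = 2 ^ 51 * (4 * D) ^ 7"
  define A where "A = 2 ^ 70 * (4 * D) ^ 10"
  define B where "B = 2 ^ 16 * (4 * D) ^ 3 * lam\<^sup>2 + 1"
  define P where "P = lam ^ (1 + 3 * B * A)"
  have "P \<le> 2 ^ ((2 * (4 * D)) ^ 198)"
    unfolding P_def using D by (intro scale_bound[OF _ lam_def A_def B_def]) auto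
  then have PL: "P \<le> L" using L by simp
  have "lam > 0" unfolding lam_def using D by simp
  then have P: "P > 0" by (simp add: P_def)
  define L' where "L' = P * (L div P + 1)"
  have "P * (L div P) \<le> L" by simp
  then have "L' \<le> 2 * L" unfolding L'_def distrib_left using PL by linarith
  have "L \<le> L'" using P by (simp add: L'_def dividend_less_times_div less_imp_le add.commute)
  then interpret big: chain_system S px py pz L' by (rule chain_system_mono)
  have "4 * D * card S < L'\<^sup>2"
  proof (rule big.not_dense[OF _ lam_def A_def B_def])
    show "lam ^ (1 + 3 * B * A) dvd L'" unfolding P_def[symmetric] L'_def by (rule dvd_triv_left)
  qed (use D P in \<open>simp_all add: L'_def\<close>)
  also have "\<dots> \<le> (2 * L)\<^sup>2" using \<open>L' \<le> 2 * L\<close> by (rule power_mono) simp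
  finally show ?thesis by (simp add: power_mult_distrib)
qed

section \<open>Towers\<close>

lemma tower_ge: "k + 1 \<le> tower k"
proof (induction k)
  case (Suc k)
  have "Suc k + 1 \<le> 2 ^ (k + 1)" by (induction k) auto
  also have "\<dots> \<le> 2 ^ tower k" using Suc by (intro power_increasing) auto
  finally show ?case by simp
qed simp

lemma tower_ge_power: "2 ^ k \<le> tower k"
proof (cases k)
  case (Suc j)
  then show ?thesis using tower_ge[of j] by (simp del: power_Suc add: power_increasing)
qed simp

lemma tower_mono: "i \<le> j \<Longrightarrow> tower i \<le> tower j"
proof (rule lift_Suc_mono_le[of tower])
  fix n show "tower n \<le> tower (Suc n)"
    using less_exp[of "tower n"] by simp
qed

lemma tower_log_star: "n \<le> tower (log_star n)"
  unfolding log_star_def by (rule LeastI[of _ n]) (use tower_ge[of n] in simp)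

lemma tower_less_of_less_log_star: "m < log_star n \<Longrightarrow> tower m < n"
  unfolding log_star_def by (drule not_less_Least) simp

text \<open>The left side is a double exponential of a linear function of \<open>log_star n\<close>,
  which lies below the tower one storey lower than \<open>log_star n\<close>, and that tower is less
  than \<open>n\<close>.\<close>

lemma log_star_large:
  assumes n: "tower 17 < n"
  shows "(2 ^ ((8 * 16 ^ log_star n) ^ 198))\<^sup>2 < n"
proof -
  define m where "m = log_star n"
  have "\<not> m \<le> 17" using tower_log_star[of n] tower_mono[of m 17] n by (auto simp: m_def)
  then obtain k where k: "m = Suc (Suc (Suc k))" "k \<ge> 14"
    by (intro that[of "m - 3"]) auto
  \<comment> \<open>Here 14 is the smallest \<open>k\<close> for which this holds, whence the
    \<open>tower 17\<close> in the hypothesis.\<close>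
  have lin: "792 * k + 2971 \<le> 2 ^ k" using k(2)
    by (induction k rule: nat_induct_at_least) auto
  have "(8 * 16 ^ m) ^ 198 = ((2 ^ (3 + 4 * m)) ^ 198 :: nat)"
    by (simp add: power_add power_mult)
  also have "\<dots> = 2 ^ (792 * k + 2970)" by (simp add: k flip: power_mult)
  finally have e: "(8 * 16 ^ m) ^ 198 = (2 ^ (792 * k + 2970) :: nat)" .
  have "(2 ^ ((8 * 16 ^ m) ^ 198))\<^sup>2 = (2 ^ (2 ^ (792 * k + 2971)) :: nat)"
    unfolding e by (simp add: mult.commute[of _ 2] flip: power_mult power_Suc)
  also have "\<dots> \<le> 2 ^ (2 ^ tower k)"
    using lin tower_ge_power[of k] by (intro power_increasing) auto
  also have "\<dots> = tower (Suc (Suc k))" by simp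
  also have "\<dots> < n" by (rule tower_less_of_less_log_star) (simp add: k(1) flip: m_def)
  finally show ?thesis by (simp add: m_def)
qed

section \<open>Paths in coloured tournaments\<close>

lemma path_edges_snoc:
  assumes "p \<noteq> []"
  shows "path_edges (p @ [v]) = insert (last p, v) (path_edges p)"
  using assms unfolding path_edges_def
proof (induction p)
  case (Cons a p)
  then show ?case by (cases p) auto
qed simp

definition avoiding :: "nat \<Rightarrow> (nat \<times> nat \<Rightarrow> nat) \<Rightarrow> nat \<Rightarrow> nat list \<Rightarrow> bool" where
  "avoiding n col k p \<longleftrightarrow> directed_path n p \<and> (\<forall>e\<in>path_edges p. col e \<noteq> k)"

definition longest_ending :: "nat \<Rightarrow> (nat \<times> nat \<Rightarrow> nat) \<Rightarrow> nat \<Rightarrow> nat \<Rightarrow> nat" where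
  "longest_ending n col k v = Max (length ` {p. avoiding n col k p \<and> last p = v})"

lemma finite_avoiding: "finite {p. avoiding n col k p}"
proof (rule finite_subset)
  show "{p. avoiding n col k p} \<subseteq> {p. set p \<subseteq> {1..n} \<and> length p \<le> n}"
  proof clarify
    fix p assume "avoiding n col k p"
    then have p: "set p \<subseteq> {1..n}" "sorted_wrt (<) p" by (auto simp: avoiding_def directed_path_def)
    then have "length p = card (set p)" by (simp add: distinct_card strict_sorted_iff)
    also have "\<dots> \<le> n" using card_mono[OF _ p(1)] by simp
    finally show "set p \<subseteq> {1..n} \<and> length p \<le> n" using p by simp
  qed
  show "finite {p. set p \<subseteq> {1..n} \<and> length p \<le> n}" by (rule finite_lists_length_le) simp
qed

lemma longest_ending_attained:
  assumes "v \<in> {1..n}"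
  obtains p where "avoiding n col k p" "last p = v" "length p = longest_ending n col k v"
proof -
  let ?P = "{p. avoiding n col k p \<and> last p = v}"
  have "[v] \<in> ?P" using assms by (simp add: avoiding_def directed_path_def path_edges_def)
  moreover have "finite ?P" by (rule finite_subset[OF _ finite_avoiding[of n col k]]) auto
  ultimately have "longest_ending n col k v \<in> length ` ?P"
    unfolding longest_ending_def by (intro Max_in) auto
  then show ?thesis using that by auto
qed

lemma longest_ending_ge:
  assumes "avoiding n col k p" "last p = v"
  shows "length p \<le> longest_ending n col k v"
proof -
  have "finite {p. avoiding n col k p \<and> last p = v}"
    by (rule finite_subset[OF _ finite_avoiding[of n col k]]) auto
  then show ?thesis unfolding longest_ending_def using assms by (intro Max_ge) auto
qed

lemma longest_ending_pos: "v \<in> {1..n} \<Longrightarrow> 0 < longest_ending n col k v"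
  by (metis avoiding_def directed_path_def length_greater_0_conv longest_ending_attained)

text \<open>Append \<open>v\<close> to a longest path ending in \<open>u\<close>; the path stays
  increasing because its last vertex is its largest.\<close>

lemma longest_ending_less:
  assumes uv: "u \<in> {1..n}" "v \<in> {1..n}" "u < v" and c: "col (u, v) \<noteq> k"
  shows "longest_ending n col k u < longest_ending n col k v"
proof -
  obtain p where p: "avoiding n col k p" "last p = u" "length p = longest_ending n col k u"
    using longest_ending_attained[OF uv(1)] .
  have ne: "p \<noteq> []" and dp: "set p \<subseteq> {1..n}" "sorted_wrt (<) p"
    using p by (auto simp: avoiding_def directed_path_def)
  have "x \<le> u" if "x \<in> set p" for x
  proof -
    obtain i where i: "i < length p" "x = p ! i" using \<open>x \<in> set p\<close> by (auto simp: in_set_conv_nth)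
    show ?thesis
    proof (cases "i = length p - 1")
      case False
      then have "p ! i < p ! (length p - 1)" using i by (intro sorted_wrt_nth_less[OF dp(2)]) auto
      then show ?thesis using i p(2) ne by (simp add: last_conv_nth)
    qed (use i p(2) ne in \<open>simp add: last_conv_nth\<close>)
  qed
  then have "x < v" if "x \<in> set p" for x using that uv(3) by (meson le_less_trans)
  then have "avoiding n col k (p @ [v])"
    using p(1,2) uv c ne dp path_edges_snoc[OF ne, of v]
    by (auto simp: avoiding_def directed_path_def sorted_wrt_append)
  then show ?thesis using longest_ending_ge[of n col k "p @ [v]" v] p(3) by simp
qed

text \<open>Equal \<open>a\<close>-coordinates force the edge to have colour \<open>a\<close>, so
  the other two coordinates both increase along it. Lengths are positive, so subtracting 1 loses
  nothing and puts the coordinates in the range from 0 to \<open>L - 1\<close>.\<close>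

lemma chain_fibres_longest_ending:
  assumes col: "\<And>u v. u \<in> {1..n} \<Longrightarrow> v \<in> {1..n} \<Longrightarrow> u < v \<Longrightarrow> col (u, v) \<in> {a, b, c}"
    and "a \<noteq> b" "b \<noteq> c" "a \<noteq> c"
  defines "f \<equiv> \<lambda>k v. longest_ending n col k v - 1"
  shows "chain_fibres {1..n} (f a) (f b) (f c)"
proof -
  have less: "f k u < f k v" if "u \<in> {1..n}" "v \<in> {1..n}" "u < v" "col (u, v) \<noteq> k" for u v k
    using longest_ending_less[of u n v col k] longest_ending_pos[of u n col k] that
    unfolding f_def by linarith
  have up: "f b u < f b v \<and> f c u < f c v"
    if "u \<in> {1..n}" "v \<in> {1..n}" "u < v" "f a u = f a v" for u v
  proof -
    have "col (u, v) = a" using less[of u v a] that by fastforce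
    then show ?thesis using less[of u v] that assms(2-4) by simp
  qed
  show ?thesis
    unfolding chain_fibres_def
  proof (intro ballI impI)
    fix u v assume "u \<in> {1..n}" "v \<in> {1..n}" "f a u = f a v"
    then show "(f b u < f b v \<longleftrightarrow> f c u < f c v) \<and> (f b u = f b v \<longrightarrow> u = v)"
      using up[of u v] up[of v u] by (cases u v rule: linorder_cases) auto
  qed
qed

theorem theorem1:
  "\<exists>c::real. c > 0 \<and> (\<exists>N::nat. \<forall>n\<ge>N. \<forall>col :: nat \<times> nat \<Rightarrow> nat.
     (\<forall>e \<in> tournament_edges n. col e \<in> {1, 2, 3}) \<longrightarrow>
     (\<exists>p. directed_path n p \<and>
          c * sqrt (real n) * exp (real (log_star n)) \<le> real (length p) \<and>
          (\<exists>k \<in> {1, 2, 3}. \<forall>e \<in> path_edges p. col e \<noteq> k)))"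
\<comment> \<open>The constant \<open>c = 1\<close> suffices, since the density saving
  \<open>16 ^ m\<close> is larger than the square of \<open>exp m\<close>.\<close>
proof (intro exI[of _ "1 :: real"] conjI exI[of _ "Suc (tower 17)"] allI impI)
  fix n :: nat and col :: "nat \<times> nat \<Rightarrow> nat"
  assume n: "Suc (tower 17) \<le> n" and col: "\<forall>e \<in> tournament_edges n. col e \<in> {1, 2, 3}"
  define m where "m = log_star n"
  define P where "P = (\<Union>k\<in>{1, 2, 3}. {p. avoiding n col k p})"
  define L where "L = Max (length ` P)"
  have finP: "finite P" by (auto simp: P_def finite_avoiding)
  have "[1] \<in> {p. avoiding n col 1 p}"
    using n by (simp add: avoiding_def directed_path_def path_edges_def)
  then have "P \<noteq> {}" by (auto simp: P_def)
  then have "L \<in> length ` P" unfolding L_def using finP by (intro Max_in) auto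
  then obtain p k where p: "avoiding n col k p" "k \<in> {1, 2, 3}" "L = length p"
    by (auto simp: P_def)
  let ?f = "\<lambda>k v. longest_ending n col k v - 1"
  have lt: "?f k v < L" if k: "k \<in> {1, 2, 3}" and v: "v \<in> {1..n}" for k v
  proof -
    obtain q where q: "avoiding n col k q" "length q = longest_ending n col k v"
      using longest_ending_attained[OF v] by metis
    then have "q \<in> P" using k by (auto simp: P_def)
    then have "length q \<le> L" unfolding L_def using finP by (intro Max_ge) auto
    then show ?thesis using q longest_ending_pos[OF v, of col k] by linarith
  qed
  have cols: "col (u, v) \<in> {1, 2, 3}" if "u \<in> {1..n}" "v \<in> {1..n}" "u < v" for u v
    using col that by (auto simp: tournament_edges_def)
  interpret chain_system "{1..n}" "?f 1" "?f 2" "?f 3" L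
  proof
    show "chain_fibres {1..n} (?f 1) (?f 2) (?f 3)"
      by (rule chain_fibres_longest_ending) (use cols in auto)
    show "chain_fibres {1..n} (?f 2) (?f 1) (?f 3)"
      by (rule chain_fibres_longest_ending) (use cols in auto)
    show "chain_fibres {1..n} (?f 3) (?f 1) (?f 2)"
      by (rule chain_fibres_longest_ending) (use cols in auto)
  qed (use lt in auto)
  \<comment> \<open>The trivial bound \<open>n \<le> L^2\<close> already makes \<open>L\<close>
    large enough for \<open>sparse\<close>.\<close>
  have "(2 ^ ((8 * 16 ^ m) ^ 198))\<^sup>2 < n" unfolding m_def by (rule log_star_large) (use n in simp)
  also have "n \<le> L\<^sup>2" using card_le by simp
  finally have "2 ^ ((8 * 16 ^ m) ^ 198) \<le> L" by (simp add: power_less_imp_less_base less_imp_le)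
  \<comment> \<open>Apply \<open>sparse\<close> to the whole vertex set. The base 16 is a power of
    two above \<open>3 ^ 2\<close>, which bounds the square of \<open>exp 1\<close>.\<close>
  then have "16 ^ m * n < L\<^sup>2" using sparse[of "16 ^ m"] by simp
  then have "real (16 ^ m * n) < real (L\<^sup>2)" by (simp only: of_nat_less_iff)
  then have "16 ^ m * real n < (real L)\<^sup>2" by simp
  moreover have "(sqrt (real n) * exp (real m))\<^sup>2 \<le> 16 ^ m * real n"
  proof -
    have "(exp (real m))\<^sup>2 = (exp 1 ^ 2) ^ m"
      by (simp add: exp_of_nat_mult[symmetric] mult.commute flip: power_mult)
    also have "\<dots> \<le> (3 ^ 2) ^ m" by (intro power_mono exp_le) auto
    also have "\<dots> \<le> 16 ^ m" by (intro power_mono) auto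
    finally show ?thesis by (simp add: power_mult_distrib mult.commute mult_left_mono)
  qed
  ultimately have "(sqrt (real n) * exp (real m))\<^sup>2 \<le> (real L)\<^sup>2" by linarith
  then have "sqrt (real n) * exp (real m) \<le> real L" by (rule power2_le_imp_le) simp
  then show "\<exists>p. directed_path n p \<and>
          1 * sqrt (real n) * exp (real (log_star n)) \<le> real (length p) \<and>
          (\<exists>k \<in> {1, 2, 3}. \<forall>e \<in> path_edges p. col e \<noteq> k)"
    using p by (intro exI[of _ p]) (auto simp: avoiding_def m_def)
qed simp

end
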